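(* The boundary $\partial G$ of any hyperbolic group $G$ is a semi-Markovian space.
   Context: $G$ is a finitely generated group, hyperbolic in the sense of Gromov; $\partial G$ is its Gromov boundary with its usual compact topology. Let $\Sigma$ be a finite alphabet and $\Sigma^{\mathbb N}$ the set of infinite words over $\Sigma$ with the product (Cantor) topology. The shift is $S((a_0,a_1,\dots))=(a_1,a_2,\dots)$, and for $F\subseteq\mathbb N$ the projection is $\pi_F:\Sigma^{\mathbb N}\to\Sigma^F$, $\pi_F((a_n)_{n\geq 0})=(a_n)_{n\in F}$. A subset $C\subseteq\Sigma^{\mathbb N}$ is a cylinder if $C=\pi_F^{-1}(A)$ for some finite $F\subseteq\mathbb N$ and some $A\subseteq\Sigma^F$. A subset $M\subseteq\Sigma^{\mathbb N}$ is a semi-Markovian set if there are cylinders $C_1,C_2$ in $\Sigma^{\mathbb N}$ with $M=C_1\cap\bigcap_{n\ge0}S^{-n}(C_2)$. A binary relation $R\subseteq\Sigma^{\mathbb N}\times\Sigma^{\mathbb N}$ is semi-Markovian if its image under the identification $((a_n)_{n\ge0},(b_n)_{n\ge0})\mapsto((a_n,b_n))_{n\ge0}$ of $\Sigma^{\mathbb N}\times\Sigma^{\mathbb N}$ with $(\Sigma\times\Sigma)^{\mathbb N}$ is a semi-Markovian set over the alphabet $\Sigma\times\Sigma$. A Hausdorff topological space $\Omega$ is a semi-Markovian space if it is (homeomorphic to) the topological quotient of a semi-Markovian set (with the topology induced from $\Sigma^{\mathbb N}$) by an equivalence relation on that set which is a semi-Markovian relation. *)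

theory Defs
  imports "HOL-Analysis.Analysis" "HOL-Algebra.Generated_Groups"
begin

definition words :: "'c set \<Rightarrow> (nat \<Rightarrow> 'c) set" where
  "words A = (UNIV \<rightarrow>\<^sub>E A)"

definition word_topology :: "'c set \<Rightarrow> (nat \<Rightarrow> 'c) topology" where
  "word_topology A = product_topology (\<lambda>_. discrete_topology A) UNIV"

lemma topspace_word_topology [simp]: "topspace (word_topology A) = words A"
  by (simp add: word_topology_def words_def)

definition shift :: "(nat \<Rightarrow> 'c) \<Rightarrow> (nat \<Rightarrow> 'c)" where
  "shift a = (\<lambda>n. a (Suc n))"

definition cylinder :: "'c set \<Rightarrow> (nat \<Rightarrow> 'c) set \<Rightarrow> bool" where
  "cylinder A C \<longleftrightarrow>
     (\<exists>F B. finite F \<and> B \<subseteq> (F \<rightarrow>\<^sub>E A) \<and> C = {a \<in> words A. restrict a F \<in> B})"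

definition semi_Markovian_set :: "'c set \<Rightarrow> (nat \<Rightarrow> 'c) set \<Rightarrow> bool" where
  "semi_Markovian_set A M \<longleftrightarrow>
     (\<exists>C1 C2. cylinder A C1 \<and> cylinder A C2 \<and>
        M = C1 \<inter> (\<Inter>n. {a \<in> words A. (shift ^^ n) a \<in> C2}))"

definition zip_words :: "(nat \<Rightarrow> 'c) \<times> (nat \<Rightarrow> 'c) \<Rightarrow> (nat \<Rightarrow> 'c \<times> 'c)" where
  "zip_words p = (\<lambda>n. (fst p n, snd p n))"

definition semi_Markovian_relation :: "'c set \<Rightarrow> (nat \<Rightarrow> 'c) rel \<Rightarrow> bool" where
  "semi_Markovian_relation A R \<longleftrightarrow>
     R \<subseteq> words A \<times> words A \<and> semi_Markovian_set (A \<times> A) (zip_words ` R)"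

definition quotient_topology :: "'c topology \<Rightarrow> 'c rel \<Rightarrow> 'c set topology" where
  "quotient_topology X R =
     topology (\<lambda>U. U \<subseteq> topspace X // R \<and> openin X {x \<in> topspace X. R `` {x} \<in> U})"

lemma openin_quotient_topology:
  "openin (quotient_topology X R) U \<longleftrightarrow>
     U \<subseteq> topspace X // R \<and> openin X {x \<in> topspace X. R `` {x} \<in> U}"
proof -
  have "istopology (\<lambda>U. U \<subseteq> topspace X // R \<and> openin X {x \<in> topspace X. R `` {x} \<in> U})"
    (is "istopology ?P")
    unfolding istopology_def
  proof (intro conjI allI impI)
    fix U V assume U: "?P U" and V: "?P V"
    have eq: "{x \<in> topspace X. R `` {x} \<in> U \<inter> V} =
       {x \<in> topspace X. R `` {x} \<in> U} \<inter> {x \<in> topspace X. R `` {x} \<in> V}" by blast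
    show "openin X {x \<in> topspace X. R `` {x} \<in> U \<inter> V}"
      unfolding eq using U V by blast
    show "U \<inter> V \<subseteq> topspace X // R" using U by blast
  next
    fix K assume K: "\<forall>U\<in>K. ?P U"
    have eq: "{x \<in> topspace X. R `` {x} \<in> \<Union>K} = (\<Union>U\<in>K. {x \<in> topspace X. R `` {x} \<in> U})"
      by blast
    show "openin X {x \<in> topspace X. R `` {x} \<in> \<Union>K}"
      unfolding eq using K by (intro openin_Union) blast
    show "\<Union>K \<subseteq> topspace X // R" using K by blast
  qed
  then show ?thesis
    by (simp add: quotient_topology_def topology_inverse')
qed

lemma topspace_quotient_topology [simp]: "topspace (quotient_topology X R) = topspace X // R"
proof -
  have "{x \<in> topspace X. R `` {x} \<in> topspace X // R} = topspace X"
    by (auto simp: quotient_def)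
  then have "openin (quotient_topology X R) (topspace X // R)"
    by (simp add: openin_quotient_topology)
  moreover have "topspace (quotient_topology X R) \<subseteq> topspace X // R"
    using openin_topspace[of "quotient_topology X R"] unfolding openin_quotient_topology by blast
  ultimately show ?thesis
    by (meson openin_subset subset_antisym)
qed

lemma quotient_map_quotient_topology:
  "quotient_map X (quotient_topology X R) (\<lambda>x. R `` {x})"
  unfolding quotient_map_def
  by (auto simp: openin_quotient_topology quotient_def)

text \<open>Every finite alphabet is in bijection with a finite set of natural numbers, so
  quantifying over the latter loses no generality.\<close>

definition semi_Markovian_space :: "'x topology \<Rightarrow> bool" where
  "semi_Markovian_space X \<longleftrightarrow>
     Hausdorff_space X \<and>
     (\<exists>(A::nat set) M R.
        finite A \<and> semi_Markovian_set A M \<and> equiv M R \<and> semi_Markovian_relation A R \<and>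
        X homeomorphic_space quotient_topology (subtopology (word_topology A) M) R)"

definition word_length :: "('a, 'm) monoid_scheme \<Rightarrow> 'a set \<Rightarrow> 'a \<Rightarrow> nat" where
  "word_length G S g =
     (LEAST n. \<exists>ws. length ws = n \<and> set ws \<subseteq> S \<union> m_inv G ` S \<and>
                    foldr (mult G) ws (one G) = g)"

definition word_dist :: "('a, 'm) monoid_scheme \<Rightarrow> 'a set \<Rightarrow> 'a \<Rightarrow> 'a \<Rightarrow> real" where
  "word_dist G S x y = real (word_length G S (mult G (m_inv G x) y))"

definition gromov_product :: "('a \<Rightarrow> 'a \<Rightarrow> real) \<Rightarrow> 'a \<Rightarrow> 'a \<Rightarrow> 'a \<Rightarrow> real" where
  "gromov_product d w x y = (d x w + d y w - d x y) / 2"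

text \<open>Gromov's four-point condition. A group \<open>G\<close> is hyperbolic if it satisfies the condition
  below for its word metric with respect to a finite generating set; whether it does, and the
  boundary up to homeomorphism, does not depend on the generating set.\<close>

definition gromov_hyperbolic :: "'a set \<Rightarrow> ('a \<Rightarrow> 'a \<Rightarrow> real) \<Rightarrow> bool" where
  "gromov_hyperbolic X d \<longleftrightarrow>
     (\<exists>\<delta>\<ge>0. \<forall>w\<in>X. \<forall>x\<in>X. \<forall>y\<in>X. \<forall>z\<in>X.
        gromov_product d w x z \<ge> min (gromov_product d w x y) (gromov_product d w y z) - \<delta>)"

text \<open>A geodesic ray of the Cayley graph that starts at the vertex \<open>\<one>\<close> is determined by the
  vertices it visits at integer times, so such rays are encoded as sequences of group elements.\<close>

definition geodesic_rays :: "('a, 'm) monoid_scheme \<Rightarrow> 'a set \<Rightarrow> (nat \<Rightarrow> 'a) set" where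
  "geodesic_rays G S =
     {c. c 0 = one G \<and> (\<forall>n. c n \<in> carrier G) \<and>
         (\<forall>m n. word_dist G S (c m) (c n) = \<bar>real m - real n\<bar>)}"

definition asymptotic :: "('a, 'm) monoid_scheme \<Rightarrow> 'a set \<Rightarrow> (nat \<Rightarrow> 'a) rel" where
  "asymptotic G S =
     {(c, c'). c \<in> geodesic_rays G S \<and> c' \<in> geodesic_rays G S \<and>
               (\<exists>K. \<forall>n. word_dist G S (c n) (c' n) \<le> K)}"

definition boundary_points :: "('a, 'm) monoid_scheme \<Rightarrow> 'a set \<Rightarrow> (nat \<Rightarrow> 'a) set set" where
  "boundary_points G S = geodesic_rays G S // asymptotic G S"

text \<open>The basic neighbourhood of \<open>p\<close>: boundary points represented by rays whose Gromov product
  with some ray representing \<open>p\<close> is asymptotically at least \<open>r\<close>.\<close>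

definition boundary_nbhd ::
    "('a, 'm) monoid_scheme \<Rightarrow> 'a set \<Rightarrow> (nat \<Rightarrow> 'a) set \<Rightarrow> real \<Rightarrow> (nat \<Rightarrow> 'a) set set" where
  "boundary_nbhd G S p r =
     {q \<in> boundary_points G S. \<exists>c\<in>p. \<exists>c'\<in>q.
        Liminf (sequentially \<times>\<^sub>F sequentially)
          (\<lambda>(m, n). ereal (gromov_product (word_dist G S) (one G) (c m) (c' n))) \<ge> ereal r}"

definition gromov_boundary :: "('a, 'm) monoid_scheme \<Rightarrow> 'a set \<Rightarrow> (nat \<Rightarrow> 'a) set topology" where
  "gromov_boundary G S =
     topology (\<lambda>U. U \<subseteq> boundary_points G S \<and> (\<forall>p\<in>U. \<exists>r. boundary_nbhd G S p r \<subseteq> U))"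

lemma boundary_nbhd_antimono:
  assumes "r \<le> r'"
  shows "boundary_nbhd G S p r' \<subseteq> boundary_nbhd G S p r"
proof -
  have "ereal r \<le> ereal r'" using assms by simp
  then show ?thesis
    unfolding boundary_nbhd_def by (blast intro: order_trans)
qed

lemma openin_gromov_boundary:
  "openin (gromov_boundary G S) U \<longleftrightarrow>
     U \<subseteq> boundary_points G S \<and> (\<forall>p\<in>U. \<exists>r. boundary_nbhd G S p r \<subseteq> U)"
proof -
  have "istopology (\<lambda>U. U \<subseteq> boundary_points G S \<and> (\<forall>p\<in>U. \<exists>r. boundary_nbhd G S p r \<subseteq> U))"
    (is "istopology ?P")
    unfolding istopology_def
  proof (intro conjI allI impI ballI)
    fix U V p assume U: "?P U" and V: "?P V" and p: "p \<in> U \<inter> V"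
    obtain r s where "boundary_nbhd G S p r \<subseteq> U" "boundary_nbhd G S p s \<subseteq> V"
      using U V p by blast
    then have "boundary_nbhd G S p (max r s) \<subseteq> U \<inter> V"
      using boundary_nbhd_antimono[of r "max r s" G S p]
        boundary_nbhd_antimono[of s "max r s" G S p] by auto
    then show "\<exists>r. boundary_nbhd G S p r \<subseteq> U \<inter> V" by blast
  next
    fix K p assume K: "\<forall>U\<in>K. ?P U" and "p \<in> \<Union>K"
    then obtain U r where "U \<in> K" "boundary_nbhd G S p r \<subseteq> U" by blast
    then show "\<exists>r. boundary_nbhd G S p r \<subseteq> \<Union>K" by blast
  qed blast+
  then show ?thesis
    by (simp add: gromov_boundary_def topology_inverse')
qed

lemma topspace_gromov_boundary [simp]:
  "topspace (gromov_boundary G S) = boundary_points G S"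
proof -
  have "openin (gromov_boundary G S) (boundary_points G S)"
    by (auto simp: openin_gromov_boundary boundary_nbhd_def)
  moreover have "topspace (gromov_boundary G S) \<subseteq> boundary_points G S"
    using openin_topspace[of "gromov_boundary G S"] unfolding openin_gromov_boundary by blast
  ultimately show ?thesis
    by (meson openin_subset subset_antisym)
qed

end

theory Submission
  imports Defs
begin

text \<open>Sample a geodesic ray from \<open>\<one>\<close> at the times \<open>12 * d * n\<close>, where \<open>d\<close> is an integral hyperbolicity
  constant, and record at each time the next step of the ray and the local picture around the current
  vertex \<open>x\<close>: the relative word lengths (Cannon's \<open>N\<close>-type) together with colours of the vertices
  near \<open>x\<close> on the same sphere. The colouring separates vertices of a sphere that are close to each
  other, and it is built so that the local picture and the step determine the next local picture;
  hence the sequences that occur are given by a condition on consecutive letters. To get a new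
  colour from finitely many, one combines the colour of an ancestor with the descent from it, and then
  reduces the number of colours again by comparison with the neighbours.

  Two rays are asymptotic iff their sampled vertices stay \<open>4 * d\<close>-close. Because of the colours, the
  letters of both rays at a time determine the displacement between the two vertices,
  so this is again a condition on consecutive letters. It is here that torsion would be an obstacle if
  one recorded only steps and \<open>N\<close>-types. Finally, the map from codes to the boundary is a continuous
  surjection from a compact space onto a Hausdorff space, hence a quotient map.\<close>

subsection \<open>Spaces of finite type over a finite alphabet\<close>

lemma shift_funpow: "(shift ^^ n) a = (\<lambda>i. a (n + i))"
  by (induction n arbitrary: a) (auto simp: shift_def funpow_swap1)

text \<open>A condition on the first letter is a cylinder over \<open>{0}\<close>, one on
  consecutive letters is a cylinder over \<open>{0, 1}\<close> moved by all shifts. The codes and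
  the kernel relation will both have this form.\<close>

lemma semi_Markovian_set_finite_type:
  "semi_Markovian_set A {a \<in> words A. I (a 0) \<and> (\<forall>n. T (a n) (a (Suc n)))}"
proof -
  define C1 where "C1 = {a \<in> words A. restrict a {0} \<in> {b \<in> {0} \<rightarrow>\<^sub>E A. I (b 0)}}"
  define C2 where "C2 = {a \<in> words A. restrict a {0, 1} \<in> {b \<in> {0, 1} \<rightarrow>\<^sub>E A. T (b 0) (b 1)}}"
  have "cylinder A C1"
    unfolding cylinder_def C1_def
    by (intro exI[of _ "{0}"] exI[of _ "{b \<in> {0} \<rightarrow>\<^sub>E A. I (b 0)}"] conjI) auto
  moreover have "cylinder A C2"
    unfolding cylinder_def C2_def
    by (intro exI[of _ "{0, 1}"] exI[of _ "{b \<in> {0, 1} \<rightarrow>\<^sub>E A. T (b 0) (b 1)}"] conjI) auto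
  moreover have "a \<in> C1 \<longleftrightarrow> a \<in> words A \<and> I (a 0)" for a
    by (auto simp: C1_def words_def PiE_iff)
  moreover have "a \<in> words A \<and> (shift ^^ n) a \<in> C2 \<longleftrightarrow> a \<in> words A \<and> T (a n) (a (Suc n))" for a n
    by (auto simp: C2_def words_def shift_funpow PiE_iff)
  ultimately have cyl: "cylinder A C1" "cylinder A C2" and "{a \<in> words A. I (a 0) \<and> (\<forall>n. T (a n) (a (Suc n)))} =
      C1 \<inter> (\<Inter>n. {a \<in> words A. (shift ^^ n) a \<in> C2})"
    by blast+
  then show ?thesis
    unfolding semi_Markovian_set_def using cyl by blast
qed

lemma openin_word_topologyI:
  assumes "finite A" "U \<subseteq> words A"
    and "\<And>a. a \<in> U \<Longrightarrow> \<exists>N. \<forall>b\<in>words A. (\<forall>i<N. b i = a i) \<longrightarrow> b \<in> U"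
  shows "openin (word_topology A) U"
  unfolding word_topology_def openin_product_topology_alt
proof
  fix a assume a: "a \<in> U"
  then obtain N where N: "\<forall>b\<in>words A. (\<forall>i<N. b i = a i) \<longrightarrow> b \<in> U"
    using assms(3) by blast
  define V where "V i = (if i < N then {a i} else A)" for i
  have "{i \<in> UNIV. V i \<noteq> topspace (discrete_topology A)} \<subseteq> {..<N}"
    by (auto simp: V_def)
  then have "finite {i \<in> UNIV. V i \<noteq> topspace (discrete_topology A)}"
    by (rule finite_subset) simp
  moreover have "\<forall>i\<in>UNIV. openin (discrete_topology A) (V i)"
    using a assms(2) by (auto simp: V_def words_def PiE_iff)
  moreover have "a \<in> Pi\<^sub>E UNIV V"
    using a assms(2) by (auto simp: V_def words_def PiE_iff)
  moreover have "Pi\<^sub>E UNIV V \<subseteq> U"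
  proof
    fix b assume b: "b \<in> Pi\<^sub>E UNIV V"
    then have bi: "b i \<in> V i" for i by auto
    have "b i \<in> A" for i
      using bi[of i] a assms(2) by (auto simp: V_def words_def split: if_splits)
    moreover have "b i = a i" if "i < N" for i
      using bi[of i] that by (simp add: V_def)
    ultimately show "b \<in> U" using N by (auto simp: words_def)
  qed
  ultimately show "\<exists>V. finite {i \<in> UNIV. V i \<noteq> topspace (discrete_topology A)} \<and>
      (\<forall>i\<in>UNIV. openin (discrete_topology A) (V i)) \<and> a \<in> Pi\<^sub>E UNIV V \<and> Pi\<^sub>E UNIV V \<subseteq> U"
    by blast
qed

lemma closedin_finite_type:
  assumes "finite A"
  shows "closedin (word_topology A) {a \<in> words A. I (a 0) \<and> (\<forall>n. T (a n) (a (Suc n)))}"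
    (is "closedin _ ?M")
proof -
  have "openin (word_topology A) (words A - ?M)"
  proof (rule openin_word_topologyI)
    fix a assume a: "a \<in> words A - ?M"
    show "\<exists>N. \<forall>b\<in>words A. (\<forall>i<N. b i = a i) \<longrightarrow> b \<in> words A - ?M"
    proof (cases "I (a 0)")
      case False
      then show ?thesis by (intro exI[of _ 1]) auto
    next
      case True
      then obtain n where "\<not> T (a n) (a (Suc n))" using a by blast
      moreover have "n < Suc (Suc n)" "Suc n < Suc (Suc n)" by auto
      ultimately show ?thesis by (intro exI[of _ "Suc (Suc n)"]) (metis (mono_tags, lifting) DiffI mem_Collect_eq)
    qed
  qed (use assms in auto)
  then show ?thesis by (auto simp: closedin_def)
qed

text \<open>Since \<open>f\<close> is constant on the classes of its kernel, it descends to a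
  quotient map on classes, which is injective and hence a homeomorphism.\<close>

lemma homeomorphic_space_quotient_topology:
  assumes f: "quotient_map X Y f"
  shows "Y homeomorphic_space
    quotient_topology X {(x, y). x \<in> topspace X \<and> y \<in> topspace X \<and> f x = f y}"
    (is "_ homeomorphic_space quotient_topology X ?R")
proof -
  define h where "h C = f (SOME x. x \<in> C)" for C
  have eq: "(h \<circ> (\<lambda>x. ?R `` {x})) x = f x" if "x \<in> topspace X" for x
  proof -
    have "x \<in> ?R `` {x}" using that by auto
    then have "(SOME y. y \<in> ?R `` {x}) \<in> ?R `` {x}" by (rule someI)
    then have "(x, SOME y. y \<in> ?R `` {x}) \<in> ?R" by (simp only: Image_singleton_iff)
    then have "f x = f (SOME y. y \<in> ?R `` {x})" by blast
    then show ?thesis by (simp only: h_def comp_def)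
  qed
  then have "quotient_map X Y (h \<circ> (\<lambda>x. ?R `` {x}))"
    using f quotient_map_eq[of X Y f] by auto
  then have q: "quotient_map (quotient_topology X ?R) Y h"
    using quotient_map_compose_eq[OF quotient_map_quotient_topology] by blast
  have "inj_on h (topspace X // ?R)"
  proof (rule inj_onI)
    fix C D assume "C \<in> topspace X // ?R" "D \<in> topspace X // ?R" and h: "h C = h D"
    then obtain x y where xy: "x \<in> topspace X" "C = ?R `` {x}" "y \<in> topspace X" "D = ?R `` {y}"
      by (auto elim!: quotientE)
    then have "f x = f y" using h eq[of x] eq[of y] by simp
    then show "C = D" using xy by auto
  qed
  then have "homeomorphic_map (quotient_topology X ?R) Y h"
    using q by (simp add: homeomorphic_map_def)
  then show ?thesis
    using homeomorphic_map_imp_homeomorphic_space homeomorphic_space_sym by blast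
qed

text \<open>A continuous surjection from a compact space onto a Hausdorff space is closed, hence a
  quotient map. Its kernel is of finite type over \<open>A \<times> A\<close>, because
  \<open>Q\<close> and membership of both words in \<open>M\<close> only involve consecutive pairs
  of letters.\<close>

lemma semi_Markovian_spaceI_nat:
  fixes A :: "nat set" and I T Q and f :: "(nat \<Rightarrow> nat) \<Rightarrow> 'x"
  defines "M \<equiv> {a \<in> words A. I (a 0) \<and> (\<forall>n. T (a n) (a (Suc n)))}"
  assumes A: "finite A" and X: "Hausdorff_space X" and surj: "f ` M = topspace X"
    and cont: "\<And>a U. a \<in> M \<Longrightarrow> openin X U \<Longrightarrow> f a \<in> U \<Longrightarrow>
      \<exists>N. \<forall>b\<in>M. (\<forall>i<N. b i = a i) \<longrightarrow> f b \<in> U"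
    and ker: "\<And>a b. a \<in> M \<Longrightarrow> b \<in> M \<Longrightarrow>
      f a = f b \<longleftrightarrow> (\<forall>n. Q (a n, b n) (a (Suc n), b (Suc n)))"
  shows "semi_Markovian_space X"
proof -
  define R where "R = {(a, b). a \<in> M \<and> b \<in> M \<and> f a = f b}"
  let ?W = "subtopology (word_topology A) M"
  have M: "M \<subseteq> words A" by (auto simp: M_def)
  then have top: "topspace ?W = M" by auto
  have "semi_Markovian_set A M"
    unfolding M_def by (rule semi_Markovian_set_finite_type)
  moreover have "equiv M R"
    by (auto simp: R_def intro!: equivI refl_onI symI transI)
  moreover have "zip_words ` R = {z \<in> words (A \<times> A).
      (I (fst (z 0)) \<and> I (snd (z 0))) \<and> (\<forall>n. T (fst (z n)) (fst (z (Suc n))) \<and>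
        T (snd (z n)) (snd (z (Suc n))) \<and> Q (z n) (z (Suc n)))}" (is "_ = ?Z")
  proof
    show "zip_words ` R \<subseteq> ?Z"
      using ker by (auto simp: R_def zip_words_def M_def words_def PiE_iff)
    show "?Z \<subseteq> zip_words ` R"
    proof
      fix z assume z: "z \<in> ?Z"
      define a b where "a = (\<lambda>n. fst (z n))" and "b = (\<lambda>n. snd (z n))"
      have ab: "a \<in> M" "b \<in> M"
        using z by (auto simp: a_def b_def M_def words_def PiE_iff mem_Times_iff)
      then have "(a, b) \<in> R" using z ker[OF ab] by (simp add: R_def a_def b_def)
      moreover have "z = zip_words (a, b)" by (auto simp: zip_words_def a_def b_def)
      ultimately show "z \<in> zip_words ` R" by blast
    qed
  qed
  then have "semi_Markovian_relation A R"
    unfolding semi_Markovian_relation_def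
    using semi_Markovian_set_finite_type[of "A \<times> A" "\<lambda>x. I (fst x) \<and> I (snd x)"
        "\<lambda>x y. T (fst x) (fst y) \<and> T (snd x) (snd y) \<and> Q x y"] M by (auto simp: R_def)
  moreover have "X homeomorphic_space quotient_topology ?W R"
  proof -
    have "compact_space (word_topology A)"
      using A by (auto simp: word_topology_def compact_space_product_topology compact_space_discrete_topology)
    moreover have "closedin (word_topology A) M"
      unfolding M_def by (rule closedin_finite_type[OF A])
    ultimately have comp: "compact_space ?W"
      by (simp add: closedin_compact_space compact_space_subtopology)
    have contf: "continuous_map ?W X f"
      unfolding continuous_map top
    proof (intro conjI allI impI)
      show "f ` M \<subseteq> topspace X" using surj by auto
      fix U assume U: "openin X U"
      \<comment> \<open>The preimage of \<open>U\<close> lives in \<open>M\<close>; \<open>V\<close>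
        extends it to an open set of all words, as a union of cylinders around points of
        \<open>M\<close>.\<close>
      define V where "V = {b \<in> words A. \<exists>a\<in>M. \<exists>N. (\<forall>i<N. b i = a i) \<and>
        (\<forall>c\<in>M. (\<forall>i<N. c i = a i) \<longrightarrow> f c \<in> U)}"
      have "openin (word_topology A) V"
      proof (rule openin_word_topologyI[OF A])
        show "V \<subseteq> words A" by (auto simp: V_def)
        fix b assume "b \<in> V"
        then obtain a N where "a \<in> M" "\<forall>i<N. b i = a i"
          "\<forall>c\<in>M. (\<forall>i<N. c i = a i) \<longrightarrow> f c \<in> U" by (auto simp: V_def)
        then show "\<exists>N. \<forall>b'\<in>words A. (\<forall>i<N. b' i = b i) \<longrightarrow> b' \<in> V"
          by (intro exI[of _ N]) (simp add: V_def, metis)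
      qed
      moreover have "{x \<in> M. f x \<in> U} = V \<inter> M"
      proof
        show "{x \<in> M. f x \<in> U} \<subseteq> V \<inter> M"
        proof
          fix x assume x: "x \<in> {x \<in> M. f x \<in> U}"
          then obtain N where "\<forall>c\<in>M. (\<forall>i<N. c i = x i) \<longrightarrow> f c \<in> U"
            using cont[OF _ U] by blast
          then show "x \<in> V \<inter> M" using x M by (auto simp: V_def)
        qed
      qed (auto simp: V_def)
      ultimately show "openin ?W {x \<in> M. f x \<in> U}"
        by (auto simp: openin_subtopology)
    qed
    have "quotient_map ?W X f"
      using continuous_closed_imp_quotient_map[OF contf continuous_imp_closed_map[OF contf comp X]]
        surj top by blast
    then show ?thesis
      using homeomorphic_space_quotient_topology[of ?W X f] unfolding R_def top by simp
  qed
  ultimately show ?thesis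
    unfolding semi_Markovian_space_def using A X by (intro conjI exI)
qed

text \<open>Letters of any type are renamed to natural numbers by an injection \<open>e\<close> with
  inverse \<open>d\<close>.\<close>

lemma semi_Markovian_spaceI:
  fixes L :: "'l set" and I T Q and f :: "(nat \<Rightarrow> 'l) \<Rightarrow> 'x"
  defines "M \<equiv> {a. (\<forall>n. a n \<in> L) \<and> I (a 0) \<and> (\<forall>n. T (a n) (a (Suc n)))}"
  assumes L: "finite L" and X: "Hausdorff_space X" and surj: "f ` M = topspace X"
    and cont: "\<And>a U. a \<in> M \<Longrightarrow> openin X U \<Longrightarrow> f a \<in> U \<Longrightarrow>
      \<exists>N. \<forall>b\<in>M. (\<forall>i<N. b i = a i) \<longrightarrow> f b \<in> U"
    and ker: "\<And>a b. a \<in> M \<Longrightarrow> b \<in> M \<Longrightarrow>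
      f a = f b \<longleftrightarrow> (\<forall>n. Q (a n, b n) (a (Suc n), b (Suc n)))"
  shows "semi_Markovian_space X"
proof -
  obtain e :: "'l \<Rightarrow> nat" where e: "inj_on e L"
    using finite_imp_inj_to_nat_seg[OF L] by metis
  define d where "d = inv_into L e"
  define A where "A = e ` L"
  have de: "d (e x) = x" if "x \<in> L" for x using e that by (simp add: d_def)
  have dA: "d x \<in> L" if "x \<in> A" for x using that de by (auto simp: A_def)
  define M' where "M' = {a \<in> words A. I (d (a 0)) \<and> (\<forall>n. T (d (a n)) (d (a (Suc n))))}"
  have M'M: "(\<lambda>n. d (a n)) \<in> M" if "a \<in> M'" for a
    using that dA by (auto simp: M'_def M_def words_def PiE_iff)
  have MM': "(\<lambda>n. e (a n)) \<in> M'" if "a \<in> M" for a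
    using that by (auto simp: M'_def M_def words_def PiE_iff A_def de)
  define f' where "f' a = f (\<lambda>n. d (a n))" for a
  show ?thesis
  proof (rule semi_Markovian_spaceI_nat[where f = f' and A = A and I = "\<lambda>x. I (d x)"
        and T = "\<lambda>x y. T (d x) (d y)" and Q = "\<lambda>p q. Q (map_prod d d p) (map_prod d d q)",
        folded M'_def])
    show "finite A" using L by (simp add: A_def)
    show "f' ` M' = topspace X"
    proof -
      have "f' (\<lambda>n. e (a n)) = f a" if "a \<in> M" for a
      proof -
        have "(\<lambda>n. d (e (a n))) = a" using that by (auto simp: M_def de)
        then show ?thesis by (simp add: f'_def)
      qed
      then have "f' ` M' = f ` M"
        using M'M MM' by (force simp: f'_def)
      then show ?thesis using surj by simp
    qed
    show "\<exists>N. \<forall>b\<in>M'. (\<forall>i<N. b i = a i) \<longrightarrow> f' b \<in> U" if a: "a \<in> M'" and U: "openin X U" "f' a \<in> U" for a U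
    proof -
      obtain N where N: "\<forall>b\<in>M. (\<forall>i<N. b i = d (a i)) \<longrightarrow> f b \<in> U"
        using cont[OF M'M[OF a] U(1)] U(2) unfolding f'_def by blast
      have "f' b \<in> U" if "b \<in> M'" "\<forall>i<N. b i = a i" for b
        using N M'M[OF that(1)] that(2) by (simp add: f'_def)
      then show ?thesis by blast
    qed
    show "(f' a = f' b) = (\<forall>n. Q (map_prod d d (a n, b n)) (map_prod d d (a (Suc n), b (Suc n))))"
      if "a \<in> M'" "b \<in> M'" for a b
      using ker[OF M'M[OF that(1)] M'M[OF that(2)]] unfolding f'_def by simp
  qed (rule X)
qed

subsection \<open>Word metrics and hyperbolicity\<close>

locale finitely_generated_group = group G for G :: "('a, 'm) monoid_scheme" (structure) +
  fixes S :: "'a set"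
  assumes finite_S: "finite S" and S_subset: "S \<subseteq> carrier G"
    and generate_S: "generate G S = carrier G"
begin

definition len :: "'a \<Rightarrow> nat" where
  "len = word_length G S"

definition ds :: "'a \<Rightarrow> 'a \<Rightarrow> nat" where
  "ds x y = len (inv x \<otimes> y)"

lemma word_dist_eq: "word_dist G S x y = real (ds x y)"
  by (simp add: word_dist_def ds_def len_def)

lemma generators_closed: "S \<union> m_inv G ` S \<subseteq> carrier G"
  using S_subset by auto

lemma foldr_closed:
  "set ws \<subseteq> S \<union> m_inv G ` S \<Longrightarrow> foldr (\<otimes>) ws \<one> \<in> carrier G"
  using generators_closed by (induction ws) auto

lemma foldr_append_mult:
  assumes "set us \<subseteq> S \<union> m_inv G ` S" "set vs \<subseteq> S \<union> m_inv G ` S"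
  shows "foldr (\<otimes>) (us @ vs) \<one> = foldr (\<otimes>) us \<one> \<otimes> foldr (\<otimes>) vs \<one>"
  using assms generators_closed foldr_closed
  by (induction us) (auto simp: m_assoc subset_iff)

lemma word_exists:
  assumes "g \<in> carrier G"
  shows "\<exists>ws. set ws \<subseteq> S \<union> m_inv G ` S \<and> foldr (\<otimes>) ws \<one> = g"
proof -
  have "g \<in> generate G S" using assms generate_S by simp
  then show ?thesis
  proof (induction rule: generate.induct)
    case one
    then show ?case by (intro exI[of _ "[]"]) simp
  next
    case (incl h)
    then show ?case using S_subset by (intro exI[of _ "[h]"]) auto
  next
    case (inv h)
    then show ?case using S_subset by (intro exI[of _ "[inv h]"]) auto
  next
    case (eng h1 h2)
    then obtain us vs where "set us \<subseteq> S \<union> m_inv G ` S" "foldr (\<otimes>) us \<one> = h1"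
      "set vs \<subseteq> S \<union> m_inv G ` S" "foldr (\<otimes>) vs \<one> = h2" by blast
    then show ?case using foldr_append_mult by (intro exI[of _ "us @ vs"]) auto
  qed
qed

lemma len_word:
  assumes "g \<in> carrier G"
  obtains ws where "length ws = len g" "set ws \<subseteq> S \<union> m_inv G ` S" "foldr (\<otimes>) ws \<one> = g"
proof -
  let ?P = "\<lambda>n. \<exists>ws. length ws = n \<and> set ws \<subseteq> S \<union> m_inv G ` S \<and> foldr (\<otimes>) ws \<one> = g"
  have "\<exists>n. ?P n" using word_exists[OF assms] by blast
  then have "?P (LEAST n. ?P n)" by (rule LeastI_ex)
  then have "?P (len g)" by (simp only: len_def word_length_def)
  then show ?thesis using that by blast
qed

lemma len_le:
  assumes "set ws \<subseteq> S \<union> m_inv G ` S"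
  shows "len (foldr (\<otimes>) ws \<one>) \<le> length ws"
  unfolding len_def word_length_def by (rule Least_le) (use assms in blast)

lemma len_one [simp]: "len \<one> = 0"
  using len_le[of "[]"] by simp

lemma len_eq_0: "g \<in> carrier G \<Longrightarrow> len g = 0 \<longleftrightarrow> g = \<one>"
  by (metis foldr_Nil id_apply length_0_conv len_one len_word)

lemma len_mult:
  assumes "g \<in> carrier G" "h \<in> carrier G"
  shows "len (g \<otimes> h) \<le> len g + len h"
proof -
  obtain us where us: "length us = len g" "set us \<subseteq> S \<union> m_inv G ` S" "foldr (\<otimes>) us \<one> = g"
    using len_word assms by blast
  obtain vs where vs: "length vs = len h" "set vs \<subseteq> S \<union> m_inv G ` S" "foldr (\<otimes>) vs \<one> = h"
    using len_word assms by blast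
  show ?thesis
    using len_le[of "us @ vs"] foldr_append_mult[of us vs] us vs by simp
qed

lemma len_inv_le:
  assumes "g \<in> carrier G"
  shows "len (inv g) \<le> len g"
proof -
  have inv_gen: "inv x \<in> S \<union> m_inv G ` S" if "x \<in> S \<union> m_inv G ` S" for x
    using that S_subset by (auto simp: image_iff)
  have *: "\<exists>vs. length vs = length ws \<and> set vs \<subseteq> S \<union> m_inv G ` S \<and>
      foldr (\<otimes>) vs \<one> = inv (foldr (\<otimes>) ws \<one>)" if "set ws \<subseteq> S \<union> m_inv G ` S" for ws
    using that
  proof (induction ws)
    case (Cons w ws)
    then obtain vs where vs: "length vs = length ws" "set vs \<subseteq> S \<union> m_inv G ` S"
      "foldr (\<otimes>) vs \<one> = inv (foldr (\<otimes>) ws \<one>)" by auto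
    have w: "w \<in> carrier G" "w \<in> S \<union> m_inv G ` S" and ws: "foldr (\<otimes>) ws \<one> \<in> carrier G"
      using Cons.prems generators_closed foldr_closed[of ws] by auto
    have "foldr (\<otimes>) (vs @ [inv w]) \<one> = inv (foldr (\<otimes>) (w # ws) \<one>)"
      using foldr_append_mult[of vs "[inv w]"] vs inv_gen[OF w(2)] w ws
      by (simp add: inv_mult_group)
    then show ?case
      using vs inv_gen[OF w(2)] by (intro exI[of _ "vs @ [inv w]"]) simp
  qed simp
  obtain ws where "length ws = len g" "set ws \<subseteq> S \<union> m_inv G ` S" "foldr (\<otimes>) ws \<one> = g"
    using len_word assms by blast
  then show ?thesis using *[of ws] len_le by metis
qed

lemma len_inv: "g \<in> carrier G \<Longrightarrow> len (inv g) = len g"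
  using len_inv_le[of g] len_inv_le[of "inv g"] by simp

text \<open>A shortest word for \<open>g\<close> is cut after \<open>m\<close> letters;
  subadditivity of \<open>len\<close> forces both pieces to be shortest. This supplies vertices at
  prescribed heights on geodesics.\<close>

lemma len_split:
  assumes "g \<in> carrier G" "len g = m + n"
  obtains h where "h \<in> carrier G" "len h = m" "len (inv h \<otimes> g) = n"
proof -
  obtain ws where ws: "length ws = len g" "set ws \<subseteq> S \<union> m_inv G ` S" "foldr (\<otimes>) ws \<one> = g"
    using len_word assms by blast
  define h k where "h = foldr (\<otimes>) (take m ws) \<one>" and "k = foldr (\<otimes>) (drop m ws) \<one>"
  have tk: "set (take m ws) \<subseteq> S \<union> m_inv G ` S" "set (drop m ws) \<subseteq> S \<union> m_inv G ` S"
    using ws(2) set_take_subset set_drop_subset by fast+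
  have cl: "h \<in> carrier G" "k \<in> carrier G"
    unfolding h_def k_def by (rule foldr_closed tk)+
  have "len h \<le> m" "len k \<le> n"
    unfolding h_def k_def using len_le[OF tk(1)] len_le[OF tk(2)] ws(1) assms(2) by auto
  moreover have g: "g = h \<otimes> k"
    using foldr_append_mult[OF tk] ws(3) by (simp add: h_def k_def)
  moreover have "inv h \<otimes> g = k" using cl g by (simp add: inv_solve_left')
  ultimately show ?thesis using that[of h] len_mult[OF cl] assms(2) cl by simp
qed

lemma finite_ball: "finite {g \<in> carrier G. len g \<le> n}"
proof -
  let ?W = "{ws. set ws \<subseteq> S \<union> m_inv G ` S \<and> length ws \<le> n}"
  have "{g \<in> carrier G. len g \<le> n} \<subseteq> (\<lambda>ws. foldr (\<otimes>) ws \<one>) ` ?W"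
  proof
    fix g assume g: "g \<in> {g \<in> carrier G. len g \<le> n}"
    then obtain ws where "length ws = len g" "set ws \<subseteq> S \<union> m_inv G ` S" "foldr (\<otimes>) ws \<one> = g"
      using len_word by blast
    then show "g \<in> (\<lambda>ws. foldr (\<otimes>) ws \<one>) ` ?W" using g by (intro image_eqI[of _ _ ws]) auto
  qed
  moreover have "finite ?W" using finite_S by (intro finite_lists_length_le) auto
  ultimately show ?thesis by (meson finite_imageI finite_subset)
qed

lemma ds_one_left [simp]: "x \<in> carrier G \<Longrightarrow> ds \<one> x = len x"
  by (simp add: ds_def)

lemma ds_self [simp]: "x \<in> carrier G \<Longrightarrow> ds x x = 0"
  by (simp add: ds_def)

lemma ds_eq_0: "x \<in> carrier G \<Longrightarrow> y \<in> carrier G \<Longrightarrow> ds x y = 0 \<longleftrightarrow> x = y"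
  by (metis ds_def inv_closed len_eq_0 m_closed inv_equality inv_inv l_inv)

lemma ds_commute: "x \<in> carrier G \<Longrightarrow> y \<in> carrier G \<Longrightarrow> ds x y = ds y x"
  using len_inv[of "inv x \<otimes> y"] by (simp add: ds_def inv_mult_group)

lemma ds_triangle:
  assumes "x \<in> carrier G" "y \<in> carrier G" "z \<in> carrier G"
  shows "ds x z \<le> ds x y + ds y z"
proof -
  have "inv x \<otimes> z = (inv x \<otimes> y) \<otimes> (inv y \<otimes> z)"
    using assms by (metis inv_closed inv_solve_left m_assoc m_closed)
  then show ?thesis unfolding ds_def using assms by (metis inv_closed len_mult m_closed)
qed

lemma ds_mult_left [simp]:
  assumes "x \<in> carrier G" "y \<in> carrier G" "z \<in> carrier G"
  shows "ds (z \<otimes> x) (z \<otimes> y) = ds x y"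
proof -
  have "inv (z \<otimes> x) \<otimes> (z \<otimes> y) = inv x \<otimes> y"
    using assms by (simp add: inv_mult_group inv_solve_left' m_assoc)
  then show ?thesis by (simp add: ds_def)
qed

lemma ds_mult_right [simp]: "x \<in> carrier G \<Longrightarrow> g \<in> carrier G \<Longrightarrow> ds x (x \<otimes> g) = len g"
  using ds_mult_left[of \<one> g x] by simp

lemma len_le_ds: "x \<in> carrier G \<Longrightarrow> y \<in> carrier G \<Longrightarrow> len y \<le> len x + ds x y"
  using ds_triangle[of \<one> x y] by simp

lemma gromov_product_eq:
  "x \<in> carrier G \<Longrightarrow> y \<in> carrier G \<Longrightarrow>
   gromov_product (word_dist G S) \<one> x y = (real (len x) + real (len y) - real (ds x y)) / 2"
  using ds_commute[of x \<one>] ds_commute[of y \<one>]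
  by (simp add: gromov_product_def word_dist_eq)

end

text \<open>\<open>four_point\<close> is Gromov's inequality at the base point
  \<open>\<one>\<close>, doubled and rearranged to avoid fractions and subtraction.\<close>

locale hyperbolic_group = finitely_generated_group +
  fixes d :: nat
  assumes d_pos: "d > 0"
    and four_point: "\<And>x y z. \<lbrakk>x \<in> carrier G; y \<in> carrier G; z \<in> carrier G\<rbrakk> \<Longrightarrow>
      ds x z + len y \<le> max (ds x y + len z) (ds y z + len x) + 2 * d"

lemma (in finitely_generated_group) hyperbolic_groupI:
  assumes "gromov_hyperbolic (carrier G) (word_dist G S)"
  obtains d where "hyperbolic_group G S d"
proof -
  obtain \<delta> where \<delta>: "\<And>w x y z. \<lbrakk>w \<in> carrier G; x \<in> carrier G; y \<in> carrier G; z \<in> carrier G\<rbrakk> \<Longrightarrow>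
      gromov_product (word_dist G S) w x z \<ge>
        min (gromov_product (word_dist G S) w x y) (gromov_product (word_dist G S) w y z) - \<delta>"
    using assms unfolding gromov_hyperbolic_def by metis
  define d where "d = Suc (nat \<lceil>\<delta>\<rceil>)"
  have d: "\<delta> \<le> real d" by (simp add: d_def) linarith
  have "hyperbolic_group G S d"
  proof unfold_locales
    show "d > 0" by (simp add: d_def)
    fix x y z assume xyz: "x \<in> carrier G" "y \<in> carrier G" "z \<in> carrier G"
    have "(real (len x) + real (len z) - real (ds x z)) / 2 \<ge>
        min ((real (len x) + real (len y) - real (ds x y)) / 2)
          ((real (len y) + real (len z) - real (ds y z)) / 2) - real d"
      using \<delta>[OF one_closed xyz] d xyz by (simp add: gromov_product_eq)
    then have "real (ds x z) + real (len y) \<le>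
        max (real (ds x y) + real (len z)) (real (ds y z) + real (len x)) + 2 * real d"
      unfolding min_def max_def by (simp split: if_splits add: field_simps)
    then have "real (ds x z + len y) \<le> real (max (ds x y + len z) (ds y z + len x) + 2 * d)"
      by (simp add: of_nat_max)
    then show "ds x z + len y \<le> max (ds x y + len z) (ds y z + len x) + 2 * d"
      by (simp only: of_nat_le_iff)
  qed
  then show ?thesis by (rule that)
qed

context hyperbolic_group
begin

text \<open>The truncated difference is twice the amount by which \<open>m\<close> exceeds the Gromov product of
  \<open>y\<close> and \<open>z\<close>.\<close>

lemma fellow_travel:
  assumes "u \<in> carrier G" "v \<in> carrier G" "y \<in> carrier G" "z \<in> carrier G"
    and "len u = m" "len v = m" "len u + ds u y = len y" "len v + ds v z = len z"
  shows "ds u v \<le> (ds y z + 2 * m - len y - len z) + 4 * d"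
proof -
  \<comment> \<open>The first inequality compares \<open>u\<close> with \<open>z\<close> through
    \<open>y\<close>, the second \<open>u\<close> with \<open>v\<close> through \<open>z\<close>;
    each costs \<open>2 * d\<close>.\<close>
  have "ds u z + len y \<le> max (ds u y + len z) (ds y z + len u) + 2 * d"
    "ds u v + len z \<le> max (ds u z + len v) (ds z v + len u) + 2 * d"
    using four_point assms by blast+
  moreover have "ds z v = ds v z" using ds_commute assms by blast
  ultimately show ?thesis using assms(5-8) by linarith
qed

end

subsection \<open>The boundary of a hyperbolic group\<close>

context hyperbolic_group
begin

abbreviation rays :: "(nat \<Rightarrow> 'a) set" where
  "rays \<equiv> geodesic_rays G S"

lemma ray_closed: "c \<in> rays \<Longrightarrow> c n \<in> carrier G"
  by (simp add: geodesic_rays_def)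

lemma ray_0: "c \<in> rays \<Longrightarrow> c 0 = \<one>"
  by (simp add: geodesic_rays_def)

lemma ray_ds:
  assumes "c \<in> rays" "m \<le> n"
  shows "ds (c m) (c n) = n - m"
proof -
  have "real (ds (c m) (c n)) = \<bar>real m - real n\<bar>"
    using assms by (simp add: geodesic_rays_def word_dist_eq)
  then have "real (ds (c m) (c n)) = real (n - m)" using assms(2) by simp
  then show ?thesis by (simp only: of_nat_eq_iff)
qed

lemma ray_len: "c \<in> rays \<Longrightarrow> len (c n) = n"
  using ray_ds[of c 0 n] by (simp add: ray_0 ray_closed)

text \<open>The path has speed at most one, so a length below \<open>n\<close> at time
  \<open>n\<close> could never be made up later, whereas full length occurs at arbitrarily late
  times.\<close>

lemma ray_cofinalI:
  assumes 0: "c 0 = \<one>" and cl: "\<And>n. c n \<in> carrier G"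
    and step: "\<And>n. ds (c n) (c (Suc n)) \<le> 1" and cofinal: "\<And>n. \<exists>m\<ge>n. len (c m) = m"
  shows "c \<in> rays"
proof -
  have le: "ds (c m) (c (m + k)) \<le> k" for m k
  proof (induction k)
    case (Suc k)
    then show ?case
      using ds_triangle[OF cl[of m] cl[of "m + k"] cl[of "m + Suc k"]] step[of "m + k"] by simp
  qed (use cl in simp)
  have len: "len (c n) = n" for n
  proof -
    obtain m where m: "m \<ge> n" "len (c m) = m" using cofinal by blast
    have "len (c n) \<le> n" using le[of 0 n] by (simp add: 0 cl)
    moreover have "m \<le> len (c n) + (m - n)"
      using len_le_ds[OF cl[of n] cl[of m]] le[of n "m - n"] m by simp
    ultimately show ?thesis using m(1) by linarith
  qed
  have eq: "ds (c m) (c n) = n - m" if "m \<le> n" for m n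
    using le[of m "n - m"] len_le_ds[OF cl cl, of n m] len that by simp
  have "real (ds (c m) (c n)) = \<bar>real m - real n\<bar>" for m n
    using eq[of m n] eq[of n m] ds_commute[OF cl cl, of m n]
    by (cases "m \<le> n") (auto simp: of_nat_diff)
  then show ?thesis using 0 cl by (simp add: geodesic_rays_def word_dist_eq)
qed

text \<open>Fellow travelling is applied at time \<open>n\<close> plus the rounded bound
  \<open>K\<close>: going back that far along both rays absorbs \<open>K\<close> and leaves a
  uniform constant.\<close>

lemma asymptotic_iff:
  "(c, c') \<in> asymptotic G S \<longleftrightarrow> c \<in> rays \<and> c' \<in> rays \<and> (\<forall>n. ds (c n) (c' n) \<le> 4 * d)"
proof
  assume "(c, c') \<in> asymptotic G S"
  then obtain K where c: "c \<in> rays" "c' \<in> rays" and K: "\<And>n. real (ds (c n) (c' n)) \<le> K"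
    by (auto simp: asymptotic_def word_dist_eq)
  have K: "ds (c n) (c' n) \<le> nat \<lceil>K\<rceil>" for n using K[of n] by linarith
  have "ds (c n) (c' n) \<le> 4 * d" for n
    using fellow_travel[of "c n" "c' n" "c (n + nat \<lceil>K\<rceil>)" "c' (n + nat \<lceil>K\<rceil>)" n]
      K[of "n + nat \<lceil>K\<rceil>"] c
    by (simp add: ray_closed ray_len ray_ds)
  then show "c \<in> rays \<and> c' \<in> rays \<and> (\<forall>n. ds (c n) (c' n) \<le> 4 * d)" using c by blast
next
  assume c: "c \<in> rays \<and> c' \<in> rays \<and> (\<forall>n. ds (c n) (c' n) \<le> 4 * d)"
  then have "real (ds (c n) (c' n)) \<le> real (4 * d)" for n by (simp only: of_nat_le_iff)
  then show "(c, c') \<in> asymptotic G S" using c by (auto simp: asymptotic_def word_dist_eq)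
qed

lemma equiv_asymptotic: "equiv rays (asymptotic G S)"
proof (rule equivI)
  show "asymptotic G S \<subseteq> rays \<times> rays" by (auto simp: asymptotic_def)
  show "refl_on rays (asymptotic G S)"
    by (auto simp: refl_on_def asymptotic_iff ray_closed)
  show "sym (asymptotic G S)"
    by (auto simp: sym_def asymptotic_iff) (metis ds_commute ray_closed)
  show "trans (asymptotic G S)"
  proof (rule transI)
    fix a b c assume "(a, b) \<in> asymptotic G S" "(b, c) \<in> asymptotic G S"
    then have abc: "a \<in> rays" "b \<in> rays" "c \<in> rays" "\<And>n. ds (a n) (b n) \<le> 4 * d"
      "\<And>n. ds (b n) (c n) \<le> 4 * d" by (auto simp: asymptotic_iff)
    have "ds (a n) (c n) \<le> 8 * d" for n
      using ds_triangle[of "a n" "b n" "c n"] abc(4,5)[of n] ray_closed abc(1-3) by fastforce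
    then have "real (ds (a n) (c n)) \<le> real (8 * d)" for n by (simp only: of_nat_le_iff)
    then show "(a, c) \<in> asymptotic G S" using abc by (auto simp: asymptotic_def word_dist_eq)
  qed
qed

lemma boundary_pointE:
  assumes "p \<in> boundary_points G S"
  obtains c where "c \<in> rays" "p = asymptotic G S `` {c}"
  using assms by (auto simp: boundary_points_def elim!: quotientE)

lemma boundary_point_rays: "p \<in> boundary_points G S \<Longrightarrow> c \<in> p \<Longrightarrow> c \<in> rays"
  by (auto elim!: boundary_pointE simp: asymptotic_iff)

lemma boundary_point_asymptotic:
  assumes "p \<in> boundary_points G S" "c \<in> p" "c' \<in> p"
  shows "ds (c n) (c' n) \<le> 4 * d"
proof -
  have "(c, c') \<in> asymptotic G S"
    using assms quotient_eq_iff[OF equiv_asymptotic, of p p c c'] by (simp add: boundary_points_def)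
  then show ?thesis by (simp add: asymptotic_iff)
qed

text \<open>An integral substitute for \<open>boundary_nbhd\<close>: some representatives have
  Gromov product at least \<open>r\<close> at all late times, doubled to clear the fraction. It
  takes the place of the \<open>Liminf\<close>.\<close>

definition near :: "(nat \<Rightarrow> 'a) set \<Rightarrow> (nat \<Rightarrow> 'a) set \<Rightarrow> nat \<Rightarrow> bool" where
  "near p q r \<longleftrightarrow>
     (\<exists>c\<in>p. \<exists>c'\<in>q. \<exists>N. \<forall>m\<ge>N. \<forall>n\<ge>N. 2 * r + ds (c m) (c' n) \<le> m + n)"

lemma ray_product_ge_iff:
  assumes "c \<in> rays" "c' \<in> rays"
  shows "real r \<le> gromov_product (word_dist G S) \<one> (c m) (c' n) \<longleftrightarrow>
    2 * r + ds (c m) (c' n) \<le> m + n"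
proof -
  have "real r \<le> gromov_product (word_dist G S) \<one> (c m) (c' n) \<longleftrightarrow>
    real (2 * r + ds (c m) (c' n)) \<le> real (m + n)"
    using assms by (auto simp: gromov_product_eq ray_closed ray_len field_simps)
  then show ?thesis by (simp only: of_nat_le_iff)
qed

lemma near_imp_boundary_nbhd:
  assumes "p \<in> boundary_points G S" "q \<in> boundary_points G S" "near p q r"
  shows "q \<in> boundary_nbhd G S p (real r)"
proof -
  obtain c c' N where c: "c \<in> p" "c' \<in> q"
    and N: "\<And>m n. m \<ge> N \<Longrightarrow> n \<ge> N \<Longrightarrow> 2 * r + ds (c m) (c' n) \<le> m + n"
    using assms(3) unfolding near_def by blast
  have rays: "c \<in> rays" "c' \<in> rays" using boundary_point_rays assms c by blast+
  have "\<forall>\<^sub>F (m, n) in sequentially \<times>\<^sub>F sequentially.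
      ereal (real r) \<le> ereal (gromov_product (word_dist G S) \<one> (c m) (c' n))"
    unfolding eventually_prod_sequentially
    by (rule exI[of _ N]) (use N ray_product_ge_iff[OF rays] in auto)
  then have "ereal (real r) \<le> Liminf (sequentially \<times>\<^sub>F sequentially)
      (\<lambda>(m, n). ereal (gromov_product (word_dist G S) \<one> (c m) (c' n)))"
    by (intro Liminf_bounded) (auto simp: case_prod_unfold)
  then show ?thesis using assms(2) c by (auto simp: boundary_nbhd_def)
qed

lemma boundary_nbhd_imp_near:
  assumes "p \<in> boundary_points G S" "q \<in> boundary_nbhd G S p (real r + 1)"
  shows "near p q r"
proof -
  obtain c c' where c: "c \<in> p" "c' \<in> q" "q \<in> boundary_points G S"
    and lim: "ereal (real r + 1) \<le> Liminf (sequentially \<times>\<^sub>F sequentially)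
      (\<lambda>(m, n). ereal (gromov_product (word_dist G S) \<one> (c m) (c' n)))"
    using assms(2) by (auto simp: boundary_nbhd_def)
  have rays: "c \<in> rays" "c' \<in> rays" using boundary_point_rays assms(1) c by blast+
  \<comment> \<open>A lower limit bounds the late values only strictly below itself, so one unit is
    given up.\<close>
  have "ereal (real r) < ereal (real r + 1)" by simp
  with lim have "\<forall>\<^sub>F x in sequentially \<times>\<^sub>F sequentially.
      ereal (real r) < (\<lambda>(m, n). ereal (gromov_product (word_dist G S) \<one> (c m) (c' n))) x"
    unfolding le_Liminf_iff by blast
  then obtain N where "\<And>m n. m \<ge> N \<Longrightarrow> n \<ge> N \<Longrightarrow>
      real r < gromov_product (word_dist G S) \<one> (c m) (c' n)"
    unfolding eventually_prod_sequentially by auto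
  then have "\<forall>m\<ge>N. \<forall>n\<ge>N. 2 * r + ds (c m) (c' n) \<le> m + n"
    using ray_product_ge_iff[OF rays] by (meson less_imp_le)
  then show ?thesis using c unfolding near_def by blast
qed

lemma near_sym:
  assumes "p \<in> boundary_points G S" "q \<in> boundary_points G S" "near p q r"
  shows "near q p r"
proof -
  obtain c c' N where c: "c \<in> p" "c' \<in> q"
    and N: "\<And>m n. m \<ge> N \<Longrightarrow> n \<ge> N \<Longrightarrow> 2 * r + ds (c m) (c' n) \<le> m + n"
    using assms(3) unfolding near_def by blast
  have "2 * r + ds (c' m) (c n) \<le> m + n" if "m \<ge> N" "n \<ge> N" for m n
    using N[OF that(2,1)] ds_commute[of "c n" "c' m"] boundary_point_rays assms c ray_closed
    by (metis add.commute)
  then show ?thesis unfolding near_def using c by blast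
qed

text \<open>The two hypotheses may use different representatives \<open>c'\<close> and
  \<open>b\<close> of \<open>q\<close>. One four-point inequality changes from \<open>c'\<close> to
  \<open>b\<close> and a second one reaches \<open>s\<close>; the surplus \<open>2 * d\<close> pays
  for both.\<close>

lemma near_trans:
  assumes pqs: "p \<in> boundary_points G S" "q \<in> boundary_points G S" "s \<in> boundary_points G S"
    and pq: "near p q (r + 2 * d)" and qs: "near q s (r + 2 * d)"
  shows "near p s r"
proof -
  obtain c c' N where c: "c \<in> p" "c' \<in> q"
    and N: "\<And>m n. m \<ge> N \<Longrightarrow> n \<ge> N \<Longrightarrow> 2 * (r + 2 * d) + ds (c m) (c' n) \<le> m + n"
    using pq unfolding near_def by blast
  obtain b b' N' where b: "b \<in> q" "b' \<in> s"
    and N': "\<And>m n. m \<ge> N' \<Longrightarrow> n \<ge> N' \<Longrightarrow> 2 * (r + 2 * d) + ds (b m) (b' n) \<le> m + n"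
    using qs unfolding near_def by blast
  have rays: "c \<in> rays" "c' \<in> rays" "b \<in> rays" "b' \<in> rays"
    using boundary_point_rays pqs b c by blast+
  note cl = ray_closed[OF rays(1)] ray_closed[OF rays(2)] ray_closed[OF rays(3)] ray_closed[OF rays(4)]
  have "2 * r + ds (c m) (b' n) \<le> m + n" if mn: "m \<ge> max N N'" "n \<ge> max N N'" for m n
  proof -
    \<comment> \<open>\<open>l\<close> is a time on the rays towards \<open>q\<close>. Being at
      least \<open>r + 4 * d\<close>, it makes the term with \<open>ds (c' l) (b l)\<close> in the
      four-point bound harmless.\<close>
    define l where "l = max (max N N') (r + 4 * d)"
    have "m \<ge> N" "l \<ge> N" "l \<ge> N'" "n \<ge> N'" using mn by (auto simp: l_def)
    then have "2 * r + 4 * d + ds (c m) (c' l) \<le> m + l" "2 * r + 4 * d + ds (b l) (b' n) \<le> l + n"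
      using N[of m l] N'[of l n] by simp_all
    moreover have "ds (c' l) (b l) \<le> 4 * d" "l \<ge> r + 4 * d"
      using boundary_point_asymptotic[OF pqs(2) c(2) b(1)] by (auto simp: l_def)
    moreover have "ds (c m) (b l) + l \<le> max (ds (c m) (c' l) + l) (ds (c' l) (b l) + m) + 2 * d"
      using four_point[of "c m" "c' l" "b l"] cl rays by (simp add: ray_len)
    moreover have "ds (c m) (b' n) + l \<le> max (ds (c m) (b l) + n) (ds (b l) (b' n) + m) + 2 * d"
      using four_point[of "c m" "b l" "b' n"] cl rays by (simp add: ray_len)
    ultimately show ?thesis by linarith
  qed
  then show ?thesis unfolding near_def using c b by blast
qed

lemma near_all_imp_eq:
  assumes pq: "p \<in> boundary_points G S" "q \<in> boundary_points G S" and near: "\<And>r. near p q r"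
  shows "p = q"
proof -
  obtain a where a: "a \<in> rays" "p = asymptotic G S `` {a}" using pq(1) by (rule boundary_pointE)
  obtain b where b: "b \<in> rays" "q = asymptotic G S `` {b}" using pq(2) by (rule boundary_pointE)
  have ab: "a \<in> p" "b \<in> q" using a b equiv_class_self[OF equiv_asymptotic] by auto
  have "ds (a n) (b n) \<le> 4 * d" for n
  proof -
    \<comment> \<open>The witnesses need not be \<open>a\<close> and \<open>b\<close>. Each
      replacement costs up to \<open>4 * d\<close>; the surplus \<open>4 * d\<close> in the index
      counts twice and pays for both.\<close>
    obtain c c' N where c: "c \<in> p" "c' \<in> q"
      and N: "\<And>i j. i \<ge> N \<Longrightarrow> j \<ge> N \<Longrightarrow> 2 * (n + 4 * d) + ds (c i) (c' j) \<le> i + j"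
      using near[of "n + 4 * d"] unfolding near_def by blast
    have rays: "c \<in> rays" "c' \<in> rays" using boundary_point_rays pq c by blast+
    define m where "m = max n N"
    have m: "m \<ge> n" "m \<ge> N" by (auto simp: m_def)
    have "ds (a m) (b m) \<le> ds (a m) (c m) + ds (c m) (b m)"
      "ds (c m) (b m) \<le> ds (c m) (c' m) + ds (c' m) (b m)"
      using ds_triangle ray_closed rays a b by auto
    moreover have "ds (a m) (c m) \<le> 4 * d" "ds (c' m) (b m) \<le> 4 * d"
      using boundary_point_asymptotic pq ab c by blast+
    moreover have "2 * n + 8 * d + ds (c m) (c' m) \<le> m + m" using N[OF m(2,2)] by simp
    ultimately have "ds (a m) (b m) + 2 * n \<le> m + m" by linarith
    then show ?thesis
      using fellow_travel[of "a n" "b n" "a m" "b m" n] m a(1) b(1)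
      by (simp add: ray_closed ray_len ray_ds)
  qed
  then have "(a, b) \<in> asymptotic G S" using a b by (simp add: asymptotic_iff)
  then show ?thesis using a b equiv_class_eq[OF equiv_asymptotic] by simp
qed

text \<open>A path through the common vertex has length \<open>(m - r) + (n - r)\<close>. Agreement
  at the single time \<open>r\<close> is enough.\<close>

lemma near_common_prefix:
  assumes "c \<in> rays" "c' \<in> rays" and eq: "c r = c' r"
  shows "near (asymptotic G S `` {c}) (asymptotic G S `` {c'}) r"
proof -
  have "2 * r + ds (c m) (c' n) \<le> m + n" if "m \<ge> r" "n \<ge> r" for m n
  proof -
    have "ds (c m) (c' n) \<le> ds (c m) (c r) + ds (c r) (c' n)"
      by (intro ds_triangle ray_closed assms)
    moreover have "ds (c m) (c r) = m - r"
      using ds_commute[of "c m" "c r"] ray_ds[OF assms(1) that(1)] assms(1) by (simp add: ray_closed)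
    moreover have "ds (c r) (c' n) = n - r"
      unfolding eq by (rule ray_ds[OF assms(2) that(2)])
    ultimately show ?thesis using that by linarith
  qed
  then show ?thesis
    unfolding near_def using assms equiv_class_self[OF equiv_asymptotic] by blast
qed

lemma near_refl: "p \<in> boundary_points G S \<Longrightarrow> near p p r"
  by (erule boundary_pointE) (simp add: near_common_prefix)

text \<open>The sets of near points need not be open. \<open>U\<close> is a kind of interior: it
  collects the points around which a whole such set fits, and \<open>near_trans\<close> makes it
  open.\<close>

lemma boundary_open_neighbourhood:
  assumes "p \<in> boundary_points G S"
  obtains U where "openin (gromov_boundary G S) U" "p \<in> U" "\<And>q. q \<in> U \<Longrightarrow> near p q r"
proof -
  define nb where "nb p r = {q \<in> boundary_points G S. near p q r}" for p and r :: nat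
  define U where "U = {q \<in> boundary_points G S. \<exists>t. nb q t \<subseteq> nb p r}"
  have "p \<in> U" using assms by (auto simp: U_def)
  moreover have "near p q r" if "q \<in> U" for q
    using that near_refl[of q] by (auto simp: U_def nb_def)
  moreover have "openin (gromov_boundary G S) U"
    unfolding openin_gromov_boundary
  proof (intro conjI ballI)
    fix q assume "q \<in> U"
    then obtain t where q: "q \<in> boundary_points G S" and t: "nb q t \<subseteq> nb p r" by (auto simp: U_def)
    have "s \<in> U" if s: "s \<in> boundary_nbhd G S q (real (t + 2 * d) + 1)" for s
    proof -
      have s': "s \<in> boundary_points G S" "near q s (t + 2 * d)"
        using s boundary_nbhd_imp_near[OF q s] by (auto simp: boundary_nbhd_def)
      then have "nb s (t + 2 * d) \<subseteq> nb q t"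
        using near_trans[OF q] by (auto simp: nb_def)
      then show ?thesis using s'(1) t by (auto simp: U_def)
    qed
    then show "\<exists>r'. boundary_nbhd G S q r' \<subseteq> U" by blast
  qed (auto simp: U_def)
  ultimately show ?thesis using that by blast
qed

lemma Hausdorff_gromov_boundary: "Hausdorff_space (gromov_boundary G S)"
  unfolding Hausdorff_space_def
proof (intro allI impI, elim conjE)
  fix p q assume p: "p \<in> topspace (gromov_boundary G S)" and q: "q \<in> topspace (gromov_boundary G S)"
    and "p \<noteq> q"
  have pq: "p \<in> boundary_points G S" "q \<in> boundary_points G S" using p q by auto
  obtain r where r: "\<not> near p q r" using near_all_imp_eq[OF pq] \<open>p \<noteq> q\<close> by blast
  obtain U where U: "openin (gromov_boundary G S) U" "p \<in> U" "\<And>s. s \<in> U \<Longrightarrow> near p s (r + 2 * d)"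
    using boundary_open_neighbourhood[OF pq(1)] by blast
  obtain V where V: "openin (gromov_boundary G S) V" "q \<in> V" "\<And>s. s \<in> V \<Longrightarrow> near q s (r + 2 * d)"
    using boundary_open_neighbourhood[OF pq(2)] by blast
  have "\<not> (near p s (r + 2 * d) \<and> near q s (r + 2 * d))" if "s \<in> boundary_points G S" for s
    using near_trans[OF pq(1) that pq(2)] near_sym[OF pq(2) that] r by blast
  then have "disjnt U V"
    using U(3) V(3) openin_subset[OF U(1)] by (auto simp: disjnt_iff)
  then show "\<exists>U V. openin (gromov_boundary G S) U \<and> openin (gromov_boundary G S) V \<and>
      p \<in> U \<and> q \<in> V \<and> disjnt U V"
    using U V by blast
qed

text \<open>This is the form of continuity that suits codes: meeting \<open>c\<close> at one late
  time suffices, however the rays run before.\<close>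

lemma ray_class_continuous:
  assumes c: "c \<in> rays" and U: "openin (gromov_boundary G S) U" "asymptotic G S `` {c} \<in> U"
  obtains N where "\<And>c' n. \<lbrakk>c' \<in> rays; n \<ge> N; c n = c' n\<rbrakk> \<Longrightarrow> asymptotic G S `` {c'} \<in> U"
proof -
  obtain r where r: "boundary_nbhd G S (asymptotic G S `` {c}) r \<subseteq> U"
    using U by (auto simp: openin_gromov_boundary)
  have "asymptotic G S `` {c'} \<in> U" if c': "c' \<in> rays" "n \<ge> nat \<lceil>r\<rceil>" "c n = c' n" for c' n
  proof -
    have "asymptotic G S `` {c'} \<in> boundary_nbhd G S (asymptotic G S `` {c}) (real n)"
      using near_common_prefix[OF c c'(1,3)] c c'(1)
      by (intro near_imp_boundary_nbhd) (auto simp: boundary_points_def quotientI)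
    moreover have "r \<le> real n" using c'(2) by linarith
    ultimately show ?thesis using r boundary_nbhd_antimono[of r "real n" G S] by blast
  qed
  then show ?thesis by (rule that)
qed

end

subsection \<open>Colour reduction\<close>

text \<open>The witness is \<open>2 ^ t\<close>: the left side is then at most 2 to the power
  \<open>(t + 1) * a + b\<close>, which is linear in \<open>t\<close>, against the exponent
  \<open>2 ^ t\<close> on the right.\<close>

lemma power_times_le_two_power: "\<exists>l::nat. (l + 1) ^ a * b \<le> 2 ^ l"
proof -
  define u t where "u = 2 * a + b" and "t = 2 * u"
  have pow: "n + 1 \<le> 2 ^ n" for n :: nat
    using less_exp[of n] by (simp add: Suc_leI)
  have "(t + 1) * a + b \<le> (2 * a + b + 1) * (u + 1)"
    by (simp add: t_def algebra_simps)
  also have "\<dots> = (u + 1) * (u + 1)" by (simp add: u_def)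
  also have "\<dots> \<le> 2 ^ u * 2 ^ u" by (intro mult_mono pow) auto
  also have "\<dots> = 2 ^ t" by (simp add: t_def mult_2 power_add)
  finally have exp: "(t + 1) * a + b \<le> 2 ^ t" .
  have "b \<le> 2 ^ b" using pow[of b] by linarith
  moreover have "(2 ^ t + 1 :: nat) \<le> 2 ^ (t + 1)" by (simp add: Suc_le_eq)
  then have "(2 ^ t + 1 :: nat) ^ a \<le> (2 ^ (t + 1)) ^ a" by (rule power_mono) simp
  ultimately have "(2 ^ t + 1 :: nat) ^ a * b \<le> (2 ^ (t + 1)) ^ a * 2 ^ b"
    by (intro mult_mono) auto
  also have "\<dots> = 2 ^ ((t + 1) * a + b)" by (simp only: power_mult power_add)
  also have "\<dots> \<le> 2 ^ (2 ^ t)" using exp by (intro power_increasing) auto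
  finally show ?thesis by blast
qed

lemma card_small_subsets_le:
  "card {I. I \<subseteq> {..<l::nat} \<and> card I \<le> k} \<le> (l + 1) ^ k"
proof -
  let ?F = "{..<k} \<rightarrow>\<^sub>E {..l}"
  have "{I. I \<subseteq> {..<l} \<and> card I \<le> k} \<subseteq> (\<lambda>f. f ` {..<k} \<inter> {..<l}) ` ?F"
  proof
    fix I assume "I \<in> {I. I \<subseteq> {..<l} \<and> card I \<le> k}"
    then have I: "I \<subseteq> {..<l}" "card I \<le> k" "finite I" by (auto intro: finite_subset)
    obtain h where h: "bij_betw h {..<card I} I"
      using ex_bij_betw_nat_finite[OF I(3)] by (auto simp: atLeast0LessThan)
    define f where "f = (\<lambda>i\<in>{..<k}. if i < card I then h i else l)"
    have hI: "h ` {..<card I} = I" using h by (simp add: bij_betw_def)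
    have "f \<in> ?F" using hI I(1) by (fastforce simp: f_def)
    moreover have "f ` {..<k} \<inter> {..<l} = I"
    proof
      show "f ` {..<k} \<inter> {..<l} \<subseteq> I" using hI by (auto simp: f_def split: if_splits)
      show "I \<subseteq> f ` {..<k} \<inter> {..<l}"
      proof
        fix i assume i: "i \<in> I"
        then obtain j where "j < card I" "i = h j" using hI by blast
        then have "i = f j" "j \<in> {..<k}" using I(2) by (auto simp: f_def)
        then show "i \<in> f ` {..<k} \<inter> {..<l}" using i I(1) by blast
      qed
    qed
    ultimately show "I \<in> (\<lambda>f. f ` {..<k} \<inter> {..<l}) ` ?F" by (intro image_eqI[of _ _ f]) auto
  qed
  then have "card {I. I \<subseteq> {..<l} \<and> card I \<le> k} \<le> card ((\<lambda>f. f ` {..<k} \<inter> {..<l}) ` ?F)"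
    by (intro card_mono finite_imageI finite_PiE) auto
  also have "\<dots> \<le> card ?F" by (intro card_image_le finite_PiE) auto
  also have "\<dots> = (l + 1) ^ k" by (simp add: card_PiE)
  finally show ?thesis .
qed

text \<open>One round of Cole-Vishkin style colour reduction. A colour in \<open>C \<times> P\<close> is written as a subset
  of \<open>{..<l}\<close>; the new colour keeps only the bits at the first positions where the old colour
  differs from those in \<open>N\<close>. The number of new colours is polynomial in \<open>l\<close>, so for large \<open>l\<close> the
  new colours fit into the set \<open>C\<close> with which one started.\<close>

lemma colour_reduction:
  fixes P :: "'p set" and k :: nat
  assumes P: "finite P"
  obtains C :: "(nat set \<times> nat set) set"
    and \<Phi> :: "(nat set \<times> nat set) \<times> 'p \<Rightarrow> ((nat set \<times> nat set) \<times> 'p) set \<Rightarrow> nat set \<times> nat set"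
  where "finite C" "({}, {}) \<in> C"
    and "\<And>e N. \<lbrakk>e \<in> C \<times> P; N \<subseteq> C \<times> P; card N \<le> k\<rbrakk> \<Longrightarrow> \<Phi> e N \<in> C"
    and "\<And>e e' N N'. \<lbrakk>e \<in> C \<times> P; e' \<in> C \<times> P; e' \<in> N; \<Phi> e N = \<Phi> e' N'\<rbrakk> \<Longrightarrow> e = e'"
proof -
  \<comment> \<open>A colour is a pair of sets of size at most \<open>k\<close>, hence the exponent
    \<open>k + k\<close>. With this \<open>l\<close> all of \<open>C \<times> P\<close> embeds into
    the subsets of \<open>{..<l}\<close>.\<close>
  obtain l where l: "(l + 1) ^ (k + k) * card P \<le> 2 ^ l"
    using power_times_le_two_power by blast
  let ?B = "{I. I \<subseteq> {..<l} \<and> card I \<le> k}"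
  define C where "C = {(I, J). I \<in> ?B \<and> J \<subseteq> I}"
  have finB: "finite ?B" by (rule finite_subset[of _ "Pow {..<l}"]) auto
  have "card J \<le> k" if "I \<in> ?B" "J \<subseteq> I" for I J
    using that card_mono[of I J] finite_subset[of I "{..<l}"] by auto
  then have CB: "C \<subseteq> ?B \<times> ?B" unfolding C_def by blast
  have finC: "finite C" using finB CB by (meson finite_SigmaI finite_subset)
  have "card C \<le> card (?B \<times> ?B)" by (intro card_mono finite_SigmaI finB CB)
  also have "\<dots> \<le> (l + 1) ^ (k + k)"
    unfolding card_cartesian_product power_add by (intro mult_mono card_small_subsets_le) auto
  finally have "card (C \<times> P) \<le> (l + 1) ^ (k + k) * card P"
    unfolding card_cartesian_product by (intro mult_mono) auto
  also have "\<dots> \<le> card (Pow {..<l})" using l by (simp add: card_Pow)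
  finally obtain E where E: "E ` (C \<times> P) \<subseteq> Pow {..<l}" "inj_on E (C \<times> P)"
    using card_le_inj[of "C \<times> P" "Pow {..<l}"] finC P by auto
  define first where "first e e' = (LEAST i. i \<in> E e \<longleftrightarrow> i \<notin> E e')" for e e'
  have first: "first e e' \<in> E e \<longleftrightarrow> first e e' \<notin> E e'"
    if "e \<in> C \<times> P" "e' \<in> C \<times> P" "e \<noteq> e'" for e e'
  proof -
    have "E e \<noteq> E e'" using that E(2) by (auto dest: inj_onD)
    then have "\<exists>i. i \<in> E e \<longleftrightarrow> i \<notin> E e'" by blast
    then show ?thesis unfolding first_def by (rule LeastI_ex)
  qed
  define pos where "pos e N = first e ` (N - {e})" for e N
  define \<Phi> where "\<Phi> e N = (pos e N, E e \<inter> pos e N)" for e N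
  show ?thesis
  proof (rule that[of C \<Phi>])
    show "\<Phi> e N \<in> C" if e: "e \<in> C \<times> P" and N: "N \<subseteq> C \<times> P" "card N \<le> k" for e N
    proof -
      have finN: "finite N" using N(1) finC P by (meson finite_SigmaI finite_subset)
      have "pos e N \<subseteq> {..<l}"
        using first[OF e] N(1) e E(1) unfolding pos_def by blast
      moreover have "card (pos e N) \<le> card (N - {e})"
        unfolding pos_def using finN by (intro card_image_le) auto
      then have "card (pos e N) \<le> k"
        using card_mono[OF finN, of "N - {e}"] N(2) by auto
      ultimately show ?thesis by (auto simp: \<Phi>_def C_def)
    qed
    show "e = e'" if e: "e \<in> C \<times> P" "e' \<in> C \<times> P" "e' \<in> N" and eq: "\<Phi> e N = \<Phi> e' N'" for e e' N N'
    proof (rule ccontr)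
      assume "e \<noteq> e'"
      \<comment> \<open>The first position where \<open>e\<close> and \<open>e'\<close> differ is
        recorded in the new colour of \<open>e\<close>; equal new colours would force equal bits
        there.\<close>
      then have "first e e' \<in> pos e N" using e(3) by (auto simp: pos_def)
      moreover have "pos e N = pos e' N'" "E e \<inter> pos e N = E e' \<inter> pos e' N'"
        using eq by (auto simp: \<Phi>_def)
      ultimately show False using first[OF e(1,2) \<open>e \<noteq> e'\<close>] by blast
    qed
  qed (use finC in \<open>auto simp: C_def\<close>)
qed

subsection \<open>Cone types\<close>

context hyperbolic_group
begin

text \<open>\<open>u\<close> is the vertex at the height of \<open>x\<close> on a geodesic from
  \<open>\<one>\<close> to \<open>z\<close>, or \<open>z\<close> itself if \<open>z\<close> is lower
  or \<open>x = y\<close>. Since \<open>z\<close> is no farther from \<open>y\<close> than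
  \<open>x\<close> is, fellow travelling costs only \<open>4 * d\<close>. The \<open>max 1\<close>
  admits neighbours when \<open>x = y\<close>.\<close>

lemma geodesic_passes_near:
  assumes cl: "x \<in> carrier G" "y \<in> carrier G" "z \<in> carrier G"
    and xy: "len y = len x + ds x y" and yz: "ds y z \<le> max 1 (ds x y)"
  obtains u where "u \<in> carrier G" "ds x u \<le> 4 * d" "len z = len u + ds u z"
proof (cases "len x \<le> len z")
  case True
  then have "len z = len x + (len z - len x)" by simp
  with cl(3) obtain u where u: "u \<in> carrier G" "len u = len x" "len (inv u \<otimes> z) = len z - len x"
    by (rule len_split)
  have uz: "ds u z = len z - len x" using u(3) by (simp add: ds_def)
  show ?thesis
  proof (cases "ds x y = 0")
    case 0: True
    then have "x = y" using ds_eq_0 cl by blast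
    then have "ds x z \<le> 1" using yz cl by simp
    then show ?thesis using that[of z] cl d_pos by simp
  next
    case False
    have "ds x u \<le> (ds y z + 2 * len x - len y - len z) + 4 * d"
      using fellow_travel[OF cl(1) u(1) cl(2,3), of "len x"] u xy uz True by simp
    then have "ds x u \<le> 4 * d" using xy yz False True by simp
    then show ?thesis using that[of u] u uz True by simp
  qed
next
  case False
  have "ds z x + len y \<le> max (ds z y + len x) (ds y x + len z) + 2 * d"
    using four_point cl by blast
  moreover have "ds z y = ds y z" "ds y x = ds x y" "ds z x = ds x z" using ds_commute cl by auto
  ultimately have "ds x z \<le> 4 * d" using xy yz False d_pos by linarith
  then show ?thesis using that[of z] cl by simp
qed

text \<open>The information in Cannon's \<open>N\<close>-types: it determines the cone of \<open>x\<close> and the lengths near the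
  vertices of the cone, because geodesics from \<open>\<one>\<close> to such vertices pass near \<open>x\<close>.\<close>

definition same_lengths :: "'a \<Rightarrow> 'a \<Rightarrow> bool" where
  "same_lengths x x' \<longleftrightarrow>
     (\<forall>g\<in>carrier G. len g \<le> 4 * d \<longrightarrow> len (x \<otimes> g) + len x' = len (x' \<otimes> g) + len x)"

lemma same_lengths_sym: "same_lengths x x' \<Longrightarrow> same_lengths x' x"
  by (simp add: same_lengths_def)

text \<open>A geodesic to \<open>x \<otimes> t\<close> passes through some
  \<open>x \<otimes> h\<close> with \<open>len h \<le> 4 * d\<close>. Its final part can be
  translated to start at \<open>x' \<otimes> h\<close>, whose relative height is the same.\<close>

lemma same_lengths_le:
  assumes cl: "x \<in> carrier G" "x' \<in> carrier G" "s \<in> carrier G" "t \<in> carrier G"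
    and same: "same_lengths x x'"
    and s: "len (x \<otimes> s) = len x + len s" and t: "ds s t \<le> max 1 (len s)"
  shows "len (x' \<otimes> t) + len x \<le> len (x \<otimes> t) + len x'"
proof -
  obtain u where u: "u \<in> carrier G" "ds x u \<le> 4 * d" "len (x \<otimes> t) = len u + ds u (x \<otimes> t)"
    using geodesic_passes_near[of x "x \<otimes> s" "x \<otimes> t"] cl s t by auto
  define h where "h = inv x \<otimes> u"
  have h: "h \<in> carrier G" "u = x \<otimes> h" "len h \<le> 4 * d"
    using u cl by (auto simp: h_def ds_def m_assoc[symmetric])
  have "len (x \<otimes> h) + len x' = len (x' \<otimes> h) + len x"
    using same h by (simp add: same_lengths_def)
  moreover have "len (x' \<otimes> t) \<le> len (x' \<otimes> h) + ds h t"
    using len_le_ds[of "x' \<otimes> h" "x' \<otimes> t"] cl h by simp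
  moreover have "len (x \<otimes> t) = len (x \<otimes> h) + ds h t" using u h cl by simp
  ultimately show ?thesis by linarith
qed

text \<open>Induction along a geodesic: the last vertex \<open>r\<close> before \<open>s\<close>
  lies in both cones, and lengths next to \<open>r\<close> can be compared. For
  \<open>r = \<one>\<close> this uses the \<open>max 1\<close> above.\<close>

lemma same_lengths_cone:
  assumes cl: "x \<in> carrier G" "x' \<in> carrier G" and same: "same_lengths x x'"
  shows "s \<in> carrier G \<Longrightarrow> len (x \<otimes> s) = len x + len s \<Longrightarrow> len (x' \<otimes> s) = len x' + len s"
proof (induction "len s" arbitrary: s)
  case 0
  then show ?case using len_eq_0 cl by simp
next
  case (Suc i)
  then have "len s = i + 1" by simp
  with Suc.prems(1) obtain r where r: "r \<in> carrier G" "len r = i" "len (inv r \<otimes> s) = 1"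
    by (rule len_split)
  have rs: "ds r s = 1" using r by (simp add: ds_def)
  have "len (x \<otimes> s) \<le> len (x \<otimes> r) + 1"
    using len_le_ds[of "x \<otimes> r" "x \<otimes> s"] cl r rs Suc.prems by simp
  moreover have "len (x \<otimes> r) \<le> len x + i" using len_mult cl r by blast
  ultimately have "len (x \<otimes> r) = len x + len r" using Suc.prems Suc.hyps r by simp
  then have "len (x' \<otimes> r) = len x' + len r" using Suc.hyps(1)[of r] r by simp
  then have "len (x \<otimes> s) + len x' \<le> len (x' \<otimes> s) + len x"
    using same_lengths_le[OF cl(2,1) r(1) Suc.prems(1) same_lengths_sym[OF same]] rs by simp
  moreover have "len (x' \<otimes> s) \<le> len x' + len s" using len_mult cl Suc.prems by blast
  ultimately show ?case using Suc.prems by linarith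
qed

lemma same_lengths_eq:
  assumes cl: "x \<in> carrier G" "x' \<in> carrier G" "s \<in> carrier G" "t \<in> carrier G"
    and same: "same_lengths x x'"
    and s: "len (x \<otimes> s) = len x + len s" and t: "ds s t \<le> len s"
  shows "len (x \<otimes> t) + len x' = len (x' \<otimes> t) + len x"
proof -
  have t': "ds s t \<le> max 1 (len s)" using t by simp
  have "len (x' \<otimes> s) = len x' + len s" by (rule same_lengths_cone[OF cl(1,2) same cl(3) s])
  then show ?thesis
    using same_lengths_le[OF cl same s t'] same_lengths_le[OF cl(2,1,3,4) same_lengths_sym[OF same] _ t']
    by simp
qed

end

subsection \<open>Colouring the spheres\<close>

text \<open>The spheres are taken at radii that are multiples of \<open>12 * d\<close>: then the ancestors of two
  vertices of a sphere at distance at most \<open>12 * d\<close> are \<open>4 * d\<close>-close.\<close>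

locale coloured_hyperbolic_group = hyperbolic_group G S d
  for G :: "('a, 'm) monoid_scheme" (structure) and S d +
  fixes C :: "'c set" and c0 :: 'c and \<Phi> :: "'c \<times> 'a \<Rightarrow> ('c \<times> 'a) set \<Rightarrow> 'c"
  assumes finite_C: "finite C" and c0: "c0 \<in> C"
    and \<Phi>_in: "\<And>e N. \<lbrakk>e \<in> C \<times> {h \<in> carrier G. len h \<le> 12 * d};
        N \<subseteq> C \<times> {h \<in> carrier G. len h \<le> 12 * d}; card N \<le> card {g \<in> carrier G. len g \<le> 8 * d}\<rbrakk>
        \<Longrightarrow> \<Phi> e N \<in> C"
    and \<Phi>_separates: "\<And>e e' N N'. \<lbrakk>e \<in> C \<times> {h \<in> carrier G. len h \<le> 12 * d};
        e' \<in> C \<times> {h \<in> carrier G. len h \<le> 12 * d}; e' \<in> N; \<Phi> e N = \<Phi> e' N'\<rbrakk> \<Longrightarrow> e = e'"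
begin

definition descents :: "'a \<Rightarrow> 'a set" where
  "descents y = {h \<in> carrier G. len h = 12 * d \<and> len (y \<otimes> h) + 12 * d = len y}"

text \<open>The choice depends on the set \<open>descents y\<close> alone, so vertices with equal
  sets of descents get the same descent.\<close>

definition descent :: "'a \<Rightarrow> 'a" where
  "descent y = (SOME h. h \<in> descents y)"

text \<open>The sphere of radius 0 has one vertex, so a constant suffices. Further out, the
  ancestor's colour and the descent tell close vertices apart, and \<open>\<Phi>\<close> compresses
  this pair into \<open>C\<close> again.\<close>

primrec colour :: "nat \<Rightarrow> 'a \<Rightarrow> 'c" where
  "colour 0 = (\<lambda>y. c0)"
| "colour (Suc n) = (\<lambda>y. \<Phi> (colour n (y \<otimes> descent y), descent y)
     {(colour n (z \<otimes> descent z), descent z) | z.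
        z \<in> carrier G \<and> len z = len y \<and> ds y z \<le> 8 * d})"

abbreviation raw_colour :: "nat \<Rightarrow> 'a \<Rightarrow> 'c \<times> 'a" where
  "raw_colour n y \<equiv> (colour n (y \<otimes> descent y), descent y)"

lemma descent:
  assumes "y \<in> carrier G" "len y = m + 12 * d"
  shows "descent y \<in> carrier G" "len (descent y) = 12 * d" "len (y \<otimes> descent y) = m"
    "descent y \<in> descents y"
proof -
  obtain h where h: "h \<in> carrier G" "len h = m" "len (inv h \<otimes> y) = 12 * d"
    using assms by (rule len_split)
  have "len (inv y \<otimes> h) = 12 * d" using h ds_commute[of y h] assms by (simp add: ds_def)
  moreover have "y \<otimes> (inv y \<otimes> h) = h" using h assms by (simp add: m_assoc[symmetric])
  ultimately have "inv y \<otimes> h \<in> descents y" using h assms by (simp add: descents_def)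
  then show "descent y \<in> descents y" unfolding descent_def by (rule someI)
  then show "descent y \<in> carrier G" "len (descent y) = 12 * d" "len (y \<otimes> descent y) = m"
    using assms by (auto simp: descents_def)
qed

text \<open>Translation to \<open>\<one>\<close> bounds the number of neighbours independently of
  \<open>y\<close>, as \<open>\<Phi>_in\<close> requires.\<close>

lemma sphere_neighbours_image:
  assumes "y \<in> carrier G"
  shows "{f z | z. z \<in> carrier G \<and> len z = len y \<and> ds y z \<le> 8 * d} \<subseteq>
    (\<lambda>g. f (y \<otimes> g)) ` {g \<in> carrier G. len g \<le> 8 * d}"
proof
  fix e assume "e \<in> {f z | z. z \<in> carrier G \<and> len z = len y \<and> ds y z \<le> 8 * d}"
  then obtain z where z: "e = f z" "z \<in> carrier G" "ds y z \<le> 8 * d" by blast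
  have "y \<otimes> (inv y \<otimes> z) = z" using z assms by (simp add: m_assoc[symmetric])
  then show "e \<in> (\<lambda>g. f (y \<otimes> g)) ` {g \<in> carrier G. len g \<le> 8 * d}"
    using z assms by (intro image_eqI[of _ _ "inv y \<otimes> z"]) (auto simp: ds_def)
qed

lemma colour_in_C: "y \<in> carrier G \<Longrightarrow> len y = 12 * d * n \<Longrightarrow> colour n y \<in> C"
proof (induction n arbitrary: y)
  case 0
  then show ?case by (simp add: c0)
next
  case (Suc n)
  have raw: "raw_colour n z \<in> C \<times> {h \<in> carrier G. len h \<le> 12 * d}"
    if "z \<in> carrier G" "len z = len y" for z
    using descent[of z "12 * d * n"] that Suc by simp
  let ?N = "{raw_colour n z | z. z \<in> carrier G \<and> len z = len y \<and> ds y z \<le> 8 * d}"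
  have "card ?N \<le> card ((\<lambda>g. raw_colour n (y \<otimes> g)) ` {g \<in> carrier G. len g \<le> 8 * d})"
    by (intro card_mono finite_imageI finite_ball sphere_neighbours_image Suc.prems)
  also have "\<dots> \<le> card {g \<in> carrier G. len g \<le> 8 * d}"
    by (intro card_image_le finite_ball)
  finally have "card ?N \<le> card {g \<in> carrier G. len g \<le> 8 * d}" .
  moreover have "?N \<subseteq> C \<times> {h \<in> carrier G. len h \<le> 12 * d}" using raw by blast
  ultimately show ?case using raw[OF Suc.prems(1)] \<Phi>_in by simp
qed

lemma ancestors_close:
  assumes "x \<in> carrier G" "x' \<in> carrier G" "y \<in> carrier G" "y' \<in> carrier G"
    and "len x = m" "len x' = m" "len y = m + 12 * d" "len y' = m + 12 * d"
    and "ds x y = 12 * d" "ds x' y' = 12 * d" "ds y y' \<le> 12 * d"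
  shows "ds x x' \<le> 4 * d"
  using fellow_travel[OF assms(1-6)] assms(5-11) by simp

text \<open>Equal colours come from equal raw colours. The ancestors are then
  \<open>4 * d\<close>-close and equally coloured, so they coincide by induction, and the common
  descent leads back to one vertex.\<close>

lemma colour_proper:
  assumes "y \<in> carrier G" "z \<in> carrier G" "len y = 12 * d * n" "len z = 12 * d * n"
    and "ds y z \<le> 8 * d" "colour n y = colour n z"
  shows "y = z"
  using assms
proof (induction n arbitrary: y z)
  case 0
  then show ?case using len_eq_0 by simp
next
  case (Suc n)
  note y = descent(1-3)[of y "12 * d * n"] and z = descent(1-3)[of z "12 * d * n"]
  have raw: "raw_colour n x \<in> C \<times> {h \<in> carrier G. len h \<le> 12 * d}"
    if "x \<in> carrier G" "len x = 12 * d * Suc n" for x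
    using descent[of x "12 * d * n"] that colour_in_C by simp
  have "raw_colour n y = raw_colour n z"
  proof (rule \<Phi>_separates)
    show "raw_colour n z \<in> {raw_colour n x | x. x \<in> carrier G \<and> len x = len y \<and> ds y x \<le> 8 * d}"
      using Suc.prems by auto
    show "\<Phi> (raw_colour n y) {raw_colour n x | x. x \<in> carrier G \<and> len x = len y \<and> ds y x \<le> 8 * d} =
        \<Phi> (raw_colour n z) {raw_colour n x | x. x \<in> carrier G \<and> len x = len z \<and> ds z x \<le> 8 * d}"
      using Suc.prems(6) by simp
  qed (use Suc.prems raw in blast)+
  then have col: "colour n (y \<otimes> descent y) = colour n (z \<otimes> descent z)" and eq: "descent y = descent z"
    by auto
  have "ds (y \<otimes> descent y) y = 12 * d" "ds (z \<otimes> descent z) z = 12 * d"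
    using y z Suc.prems ds_commute[of "y \<otimes> descent y" y] ds_commute[of "z \<otimes> descent z" z] by auto
  then have "ds (y \<otimes> descent y) (z \<otimes> descent z) \<le> 4 * d"
    using ancestors_close[of "y \<otimes> descent y" "z \<otimes> descent z" y z "12 * d * n"] y z Suc.prems by simp
  then have "y \<otimes> descent y = z \<otimes> descent z"
    using y z Suc.prems col by (intro Suc.IH) auto
  then show ?case using eq y z Suc.prems by (metis add.commute mult_Suc_right right_cancel)
qed

text \<open>All data are relative to \<open>x\<close>, so labels can recur at other vertices. Off
  the sphere of \<open>x\<close> the default \<open>c0\<close> is used, because
  \<open>colour n\<close> is controlled on one sphere only.\<close>

definition label :: "nat \<Rightarrow> 'a \<Rightarrow> 'a \<Rightarrow> int \<times> 'c" where
  "label n x = (\<lambda>g\<in>{g \<in> carrier G. len g \<le> 4 * d}.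
     (int (len (x \<otimes> g)) - int (len x),
      if len (x \<otimes> g) = len x then colour n (x \<otimes> g) else c0))"

definition labels :: "('a \<Rightarrow> int \<times> 'c) set" where
  "labels = {g \<in> carrier G. len g \<le> 4 * d} \<rightarrow>\<^sub>E {- int (4 * d)..int (4 * d)} \<times> C"

lemma finite_labels: "finite labels"
  unfolding labels_def using finite_C finite_ball by (intro finite_PiE finite_SigmaI) auto

lemma label_in_labels:
  assumes x: "x \<in> carrier G" "len x = 12 * d * n"
  shows "label n x \<in> labels"
proof -
  have "int (len (x \<otimes> g)) - int (len x) \<in> {- int (4 * d)..int (4 * d)}"
    if g: "g \<in> carrier G" "len g \<le> 4 * d" for g
  proof -
    have "len (x \<otimes> g) \<le> len x + len g" by (intro len_mult x g)
    moreover have "len x \<le> len (x \<otimes> g) + ds (x \<otimes> g) x" by (intro len_le_ds m_closed x g)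
    moreover have "ds (x \<otimes> g) x = len g" using ds_commute[of "x \<otimes> g" x] x g by simp
    ultimately show ?thesis using g(2) unfolding atLeastAtMost_iff by linarith
  qed
  then show ?thesis
    using x c0 colour_in_C unfolding labels_def label_def by auto
qed

lemma label_eqD:
  assumes eq: "label n x = label n' x'" and g: "g \<in> carrier G" "len g \<le> 4 * d"
  shows "len (x \<otimes> g) + len x' = len (x' \<otimes> g) + len x"
    and "len (x \<otimes> g) = len x \<Longrightarrow> colour n (x \<otimes> g) = colour n' (x' \<otimes> g)"
proof -
  have "label n x g = label n' x' g" by (simp only: eq)
  then have *: "int (len (x \<otimes> g)) - int (len x) = int (len (x' \<otimes> g)) - int (len x')"
    "(if len (x \<otimes> g) = len x then colour n (x \<otimes> g) else c0) =
     (if len (x' \<otimes> g) = len x' then colour n' (x' \<otimes> g) else c0)"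
    using g by (auto simp: label_def)
  then show "len (x \<otimes> g) + len x' = len (x' \<otimes> g) + len x" by linarith
  with * show "len (x \<otimes> g) = len x \<Longrightarrow> colour n (x \<otimes> g) = colour n' (x' \<otimes> g)" by simp
qed

lemma label_eq_same_lengths: "label n x = label n' x' \<Longrightarrow> same_lengths x x'"
  using label_eqD(1) by (auto simp: same_lengths_def)

text \<open>Ancestors of \<open>x \<otimes> t\<close> lie within \<open>4 * d\<close> of
  \<open>x\<close>, so the ball that \<open>same_lengths\<close> controls decides which
  \<open>h\<close> are descents.\<close>

lemma descents_mult_subset:
  assumes cl: "x \<in> carrier G" "x' \<in> carrier G" "s \<in> carrier G" "t \<in> carrier G"
    and same: "same_lengths x x'" and s: "len s = 12 * d" "len (x \<otimes> s) = len x + 12 * d"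
    and t: "ds s t \<le> 12 * d" "len (x \<otimes> t) = len x + 12 * d" "len (x' \<otimes> t) = len x' + 12 * d"
    and h: "h \<in> descents (x \<otimes> t)"
  shows "len (t \<otimes> h) \<le> 4 * d" "h \<in> descents (x' \<otimes> t)"
proof -
  have h': "h \<in> carrier G" "len h = 12 * d" "len (x \<otimes> t \<otimes> h) = len x"
    using h t(2) by (auto simp: descents_def)
  have "ds x (x \<otimes> t \<otimes> h) \<le> 4 * d"
    using ancestors_close[of x "x \<otimes> t \<otimes> h" "x \<otimes> s" "x \<otimes> t" "len x"]
      ds_commute[of "x \<otimes> t \<otimes> h" "x \<otimes> t"] cl s t h' by simp
  then show th: "len (t \<otimes> h) \<le> 4 * d" using cl h' by (simp add: m_assoc)
  then have "len (x' \<otimes> (t \<otimes> h)) = len x'"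
    using same h' cl by (auto simp: same_lengths_def m_assoc)
  then show "h \<in> descents (x' \<otimes> t)" using h' cl t by (simp add: descents_def m_assoc)
qed

text \<open>The labels determine the set of descents and hence the chosen one; the ancestor it
  reaches is near \<open>x\<close> on the same sphere, where the label records its colour.\<close>

lemma raw_colour_eq:
  assumes cl: "x \<in> carrier G" "x' \<in> carrier G" "s \<in> carrier G" "t \<in> carrier G"
    and eq: "label n x = label n' x'" and s: "len s = 12 * d" "len (x \<otimes> s) = len x + 12 * d"
    and t: "ds s t \<le> 12 * d" "len (x \<otimes> t) = len x + 12 * d"
  shows "raw_colour n (x \<otimes> t) = raw_colour n' (x' \<otimes> t)"
proof -
  note same = label_eq_same_lengths[OF eq] and same' = label_eq_same_lengths[OF eq[symmetric]]
  have s': "len (x' \<otimes> s) = len x' + 12 * d"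
    using same_lengths_cone[OF cl(1,2) same cl(3)] s by simp
  have t': "len (x' \<otimes> t) = len x' + 12 * d"
    using same_lengths_eq[OF cl same] s t by simp
  have "descents (x \<otimes> t) = descents (x' \<otimes> t)"
    using descents_mult_subset(2)[OF cl same s t t'] 
      descents_mult_subset(2)[OF cl(2,1,3,4) same' s(1) s' t(1) t' t(2)] by blast
  then have de: "descent (x \<otimes> t) = descent (x' \<otimes> t)" by (simp add: descent_def)
  define h where "h = descent (x \<otimes> t)"
  have h: "h \<in> carrier G" "len (x \<otimes> t \<otimes> h) = len x" "h \<in> descents (x \<otimes> t)"
    using descent[of "x \<otimes> t" "len x"] cl t by (auto simp: h_def)
  have "len (t \<otimes> h) \<le> 4 * d"
    using descents_mult_subset(1)[OF cl same s t t' h(3)] .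
  then have "colour n (x \<otimes> (t \<otimes> h)) = colour n' (x' \<otimes> (t \<otimes> h))"
    using label_eqD(2)[OF eq, of "t \<otimes> h"] cl h by (simp add: m_assoc)
  then show ?thesis using de cl h by (simp add: m_assoc h_def[symmetric])
qed

text \<open>The new colour involves raw colours within \<open>8 * d\<close> of
  \<open>x \<otimes> t\<close>. These vertices are within \<open>4 * d + 8 * d\<close> of
  \<open>x \<otimes> s\<close>, which is the range of \<open>raw_colour_eq\<close>.\<close>

lemma colour_Suc_eq:
  assumes cl: "x \<in> carrier G" "x' \<in> carrier G" "s \<in> carrier G" "t \<in> carrier G"
    and eq: "label n x = label n' x'" and s: "len s = 12 * d" "len (x \<otimes> s) = len x + 12 * d"
    and t: "ds s t \<le> 4 * d" "len (x \<otimes> t) = len x + 12 * d"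
  shows "colour (Suc n) (x \<otimes> t) = colour (Suc n') (x' \<otimes> t)"
proof -
  \<comment> \<open>Stated for arbitrary vertices, so that exchanging \<open>x\<close> and
    \<open>x'\<close> gives the reverse inclusion.\<close>
  have sub: "{raw_colour n z | z. z \<in> carrier G \<and> len z = len (x \<otimes> t) \<and> ds (x \<otimes> t) z \<le> 8 * d} \<subseteq>
      {raw_colour n' z | z. z \<in> carrier G \<and> len z = len (x' \<otimes> t) \<and> ds (x' \<otimes> t) z \<le> 8 * d}"
    if cl: "x \<in> carrier G" "x' \<in> carrier G" and eq: "label n x = label n' x'"
      and s2: "len (x \<otimes> s) = len x + 12 * d" and t2: "len (x \<otimes> t) = len x + 12 * d"
    for x x' n n'
  proof
    note same = label_eq_same_lengths[OF eq]
    fix e assume "e \<in> {raw_colour n z | z. z \<in> carrier G \<and> len z = len (x \<otimes> t) \<and> ds (x \<otimes> t) z \<le> 8 * d}"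
    then obtain z where z: "e = raw_colour n z" "z \<in> carrier G" "len z = len (x \<otimes> t)"
      "ds (x \<otimes> t) z \<le> 8 * d" by blast
    define w where "w = inv x \<otimes> z"
    have w: "w \<in> carrier G" "z = x \<otimes> w" using z cl by (auto simp: w_def m_assoc[symmetric])
    then have "ds t w \<le> 8 * d" using z cl assms(4) by simp
    then have sw: "ds s w \<le> 12 * d" using ds_triangle[of s t w] t(1) w assms(3,4) by simp
    have "len (x \<otimes> w) = len x + 12 * d" using w z t2 by simp
    then have "e = raw_colour n' (x' \<otimes> w)"
      unfolding z(1) w(2) by (rule raw_colour_eq[OF cl assms(3) w(1) eq s(1) s2 sw])
    moreover have "len (x' \<otimes> w) = len x' + 12 * d"
      using same_lengths_eq[OF cl assms(3) w(1) same] s(1) s2 sw w z t2 by simp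
    moreover have "len (x' \<otimes> t) = len x' + 12 * d"
      using same_lengths_eq[OF cl assms(3,4) same] s(1) s2 t(1) t2 by simp
    ultimately show "e \<in> {raw_colour n' z | z. z \<in> carrier G \<and> len z = len (x' \<otimes> t) \<and> ds (x' \<otimes> t) z \<le> 8 * d}"
      using w cl \<open>ds t w \<le> 8 * d\<close> assms(4) by (intro CollectI exI[of _ "x' \<otimes> w"]) simp
  qed
  note same = label_eq_same_lengths[OF eq]
  have s': "len (x' \<otimes> s) = len x' + 12 * d"
    using same_lengths_cone[OF cl(1,2) same cl(3)] s by simp
  have t': "len (x' \<otimes> t) = len x' + 12 * d"
    using same_lengths_eq[OF cl same] s t by simp
  have "ds s t \<le> 12 * d" using t(1) by simp
  from raw_colour_eq[OF cl eq s this t(2)]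
  have "raw_colour n (x \<otimes> t) = raw_colour n' (x' \<otimes> t)" .
  moreover have "{raw_colour n z | z. z \<in> carrier G \<and> len z = len (x \<otimes> t) \<and> ds (x \<otimes> t) z \<le> 8 * d} =
      {raw_colour n' z | z. z \<in> carrier G \<and> len z = len (x' \<otimes> t) \<and> ds (x' \<otimes> t) z \<le> 8 * d}"
    by (rule subset_antisym[OF sub[OF cl(1,2) eq s(2) t(2)] sub[OF cl(2,1) eq[symmetric] s' t']])
  ultimately show ?thesis by (simp only: colour.simps)
qed

text \<open>Labels evolve deterministically along a step: relative lengths by
  \<open>same_lengths_eq\<close>, colours by \<open>colour_Suc_eq\<close>. Any vertex may therefore
  stand for its label.\<close>

lemma label_determines_next:
  assumes cl: "x \<in> carrier G" "x' \<in> carrier G" "s \<in> carrier G"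
    and eq: "label n x = label n' x'" and s: "len s = 12 * d" "len (x \<otimes> s) = len x + 12 * d"
  shows "len (x' \<otimes> s) = len x' + 12 * d" "label (Suc n) (x \<otimes> s) = label (Suc n') (x' \<otimes> s)"
proof -
  note same = label_eq_same_lengths[OF eq]
  show s': "len (x' \<otimes> s) = len x' + 12 * d"
    using same_lengths_cone[OF cl(1,2) same cl(3)] s by simp
  have "label (Suc n) (x \<otimes> s) g = label (Suc n') (x' \<otimes> s) g"
    if g: "g \<in> carrier G" "len g \<le> 4 * d" for g
  proof -
    have l: "len (x \<otimes> (s \<otimes> g)) + len x' = len (x' \<otimes> (s \<otimes> g)) + len x"
      using same_lengths_eq[OF cl(1,2,3) _ same, of "s \<otimes> g"] s g cl by simp
    have c: "colour (Suc n) (x \<otimes> (s \<otimes> g)) = colour (Suc n') (x' \<otimes> (s \<otimes> g))"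
      if "len (x \<otimes> (s \<otimes> g)) = len x + 12 * d"
      using colour_Suc_eq[OF cl _ eq s _ that] g cl by simp
    have a: "x \<otimes> s \<otimes> g = x \<otimes> (s \<otimes> g)" "x' \<otimes> s \<otimes> g = x' \<otimes> (s \<otimes> g)" using cl g by (auto simp: m_assoc)
    have "int (len (x \<otimes> (s \<otimes> g))) - int (len x) = int (len (x' \<otimes> (s \<otimes> g))) - int (len x')"
      using l by linarith
    moreover have "len (x \<otimes> (s \<otimes> g)) = len x + 12 * d \<longleftrightarrow> len (x' \<otimes> (s \<otimes> g)) = len x' + 12 * d"
      using l by linarith
    ultimately show ?thesis using g c by (simp add: label_def a s(2) s' del: colour.simps)
  qed
  then show "label (Suc n) (x \<otimes> s) = label (Suc n') (x' \<otimes> s)"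
    by (intro ext) (auto simp: label_def)
qed

end

subsection \<open>Coding the boundary\<close>

context hyperbolic_group
begin

lemma geodesic_path:
  "g \<in> carrier G \<Longrightarrow> len g = k \<Longrightarrow> \<exists>p. p 0 = \<one> \<and> p k = g \<and> (\<forall>i. p i \<in> carrier G) \<and>
     (\<forall>i<k. ds (p i) (p (Suc i)) \<le> 1)"
proof (induction k arbitrary: g)
  case 0
  then show ?case using len_eq_0 by (intro exI[of _ "\<lambda>_. \<one>"]) auto
next
  case (Suc k)
  then have "len g = k + 1" by simp
  with Suc.prems(1) obtain h where h: "h \<in> carrier G" "len h = k" "len (inv h \<otimes> g) = 1"
    by (rule len_split)
  then obtain p where p: "p 0 = \<one>" "p k = h" "\<forall>i. p i \<in> carrier G"
    "\<forall>i<k. ds (p i) (p (Suc i)) \<le> 1" using Suc.IH by blast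
  have "ds h g \<le> 1" using h by (simp add: ds_def)
  then show ?case
    using p Suc.prems by (intro exI[of _ "p(Suc k := g)"]) (auto simp: less_Suc_eq)
qed

text \<open>Geodesic pieces are joined at the given points; \<open>ray_cofinalI\<close> needs the
  correct length at the joints only.\<close>

lemma ray_through:
  assumes K: "K > 0" and cl: "\<And>n. x n \<in> carrier G" and len: "\<And>n. len (x n) = K * n"
    and step: "\<And>n. ds (x n) (x (Suc n)) = K"
  obtains c where "c \<in> rays" "\<And>n. c (K * n) = x n"
proof -
  have "\<exists>p. p 0 = \<one> \<and> p K = inv (x n) \<otimes> x (Suc n) \<and> (\<forall>i. p i \<in> carrier G) \<and>
     (\<forall>i<K. ds (p i) (p (Suc i)) \<le> 1)" for n
    using step[of n] cl by (intro geodesic_path) (auto simp: ds_def)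
  then obtain p where p: "\<And>n. p n 0 = \<one>" "\<And>n. p n K = inv (x n) \<otimes> x (Suc n)"
    "\<And>n i. p n i \<in> carrier G" "\<And>n i. i < K \<Longrightarrow> ds (p n i) (p n (Suc i)) \<le> 1" by metis
  define c where "c m = x (m div K) \<otimes> p (m div K) (m mod K)" for m
  have x_Suc: "x (Suc n) = x n \<otimes> p n K" for n
    using p(2)[of n] cl by (simp add: m_assoc[symmetric])
  have Kn: "c (K * n) = x n" for n using K cl p(1) by (simp add: c_def)
  have "c \<in> rays"
  proof (rule ray_cofinalI)
    show "c 0 = \<one>" using Kn[of 0] len[of 0] len_eq_0[OF cl] by simp
    show cc: "c n \<in> carrier G" for n using cl p(3) by (simp add: c_def)
    show "ds (c n) (c (Suc n)) \<le> 1" for n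
    proof -
      \<comment> \<open>At the end of a block the last vertex of one piece is the first of the next,
        so the formula with the old block index stays valid.\<close>
      have "c (Suc n) = x (n div K) \<otimes> p (n div K) (Suc (n mod K))"
      proof (cases "Suc (n mod K) = K")
        case True
        then show ?thesis using x_Suc[of "n div K"] p(1,3) cl by (simp add: c_def div_Suc mod_Suc)
      next
        case False
        then show ?thesis by (simp add: c_def div_Suc mod_Suc)
      qed
      then show ?thesis using p(4)[of "n mod K" "n div K"] p(3) cl K by (simp add: c_def)
    qed
    show "\<exists>m\<ge>n. len (c m) = m" for n
      using Kn[of n] len[of n] K by (intro exI[of _ "K * n"]) auto
  qed
  then show ?thesis using Kn by (rule that)
qed

lemma asymptotic_sampledI:
  assumes "c \<in> rays" "c' \<in> rays" "K > 0" and B: "\<And>n. ds (c (K * n)) (c' (K * n)) \<le> B"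
  shows "(c, c') \<in> asymptotic G S"
proof -
  have "ds (c n) (c' n) \<le> B + 2 * K" for n
  proof -
    define m where "m = K * (n div K)"
    have m: "m \<le> n" "n - m < K"
      using assms(3) by (auto simp: m_def minus_mult_div_eq_mod[of n K, simplified mult.commute])
    have "ds (c n) (c' n) \<le> ds (c n) (c m) + ds (c m) (c' n)"
      "ds (c m) (c' n) \<le> ds (c m) (c' m) + ds (c' m) (c' n)"
      using assms by (auto intro!: ds_triangle ray_closed)
    moreover have "ds (c n) (c m) = n - m" "ds (c' m) (c' n) = n - m"
      using ray_ds[OF assms(1) m(1)] ray_ds[OF assms(2) m(1)] ds_commute[of "c n" "c m"] assms
      by (auto simp: ray_closed)
    ultimately show ?thesis using B[of "n div K"] m unfolding m_def by linarith
  qed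
  then have "real (ds (c n) (c' n)) \<le> real (B + 2 * K)" for n by (simp only: of_nat_le_iff)
  then show ?thesis using assms by (auto simp: asymptotic_def word_dist_eq)
qed

end

context coloured_hyperbolic_group
begin

section \<open>Letters, codes and their vertices\<close>

definition letters :: "(('a \<Rightarrow> int \<times> 'c) \<times> 'a) set" where
  "letters = labels \<times> {s \<in> carrier G. len s = 12 * d}"

text \<open>Some vertex has to realise the transition. By \<open>label_determines_next\<close> its
  choice does not matter, so this is a condition on two letters.\<close>

definition next_letter :: "('a \<Rightarrow> int \<times> 'c) \<times> 'a \<Rightarrow> ('a \<Rightarrow> int \<times> 'c) \<times> 'a \<Rightarrow> bool" where
  "next_letter a b \<longleftrightarrow> (\<exists>n x. x \<in> carrier G \<and> len x = 12 * d * n \<and> label n x = fst a \<and>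
     len (x \<otimes> snd a) = len x + 12 * d \<and> label (Suc n) (x \<otimes> snd a) = fst b)"

definition codes :: "(nat \<Rightarrow> ('a \<Rightarrow> int \<times> 'c) \<times> 'a) set" where
  "codes = {a. (\<forall>n. a n \<in> letters) \<and> fst (a 0) = label 0 \<one> \<and> (\<forall>n. next_letter (a n) (a (Suc n)))}"

primrec vertex :: "(nat \<Rightarrow> ('a \<Rightarrow> int \<times> 'c) \<times> 'a) \<Rightarrow> nat \<Rightarrow> 'a" where
  "vertex a 0 = \<one>"
| "vertex a (Suc n) = vertex a n \<otimes> snd (a n)"

lemma vertex_cong: "(\<forall>i<n. a i = b i) \<Longrightarrow> vertex a n = vertex b n"
  by (induction n) auto

lemma codes_step:
  assumes "a \<in> codes"
  shows "snd (a n) \<in> carrier G" "len (snd (a n)) = 12 * d"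
proof -
  have "a n \<in> letters" using assms by (simp add: codes_def)
  then show "snd (a n) \<in> carrier G" "len (snd (a n)) = 12 * d" by (auto simp: letters_def)
qed

lemma vertex_closed: "a \<in> codes \<Longrightarrow> vertex a n \<in> carrier G"
  by (induction n) (auto simp: codes_step)

text \<open>The vertex witnessing \<open>next_letter\<close> may lie anywhere, but it shares its
  label with \<open>vertex a n\<close>, so the step has the same effect there. Local admissibility
  thus yields a geodesic.\<close>

lemma vertex_label:
  assumes "a \<in> codes"
  shows "len (vertex a n) = 12 * d * n \<and> label n (vertex a n) = fst (a n)"
proof (induction n)
  case 0
  then show ?case using assms by (simp add: codes_def)
next
  case (Suc n)
  have "next_letter (a n) (a (Suc n))" using assms by (simp add: codes_def)
  then obtain m x where x: "x \<in> carrier G" "len x = 12 * d * m" "label m x = fst (a n)"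
    "len (x \<otimes> snd (a n)) = len x + 12 * d" "label (Suc m) (x \<otimes> snd (a n)) = fst (a (Suc n))"
    unfolding next_letter_def by blast
  have "label m x = label n (vertex a n)" using x Suc by simp
  from label_determines_next[OF x(1) vertex_closed[OF assms] codes_step(1)[OF assms] this
      codes_step(2)[OF assms] x(4)]
  show ?case using x(5) Suc by simp
qed

lemma vertex_ds_Suc: "a \<in> codes \<Longrightarrow> ds (vertex a n) (vertex a (Suc n)) = 12 * d"
  by (simp add: vertex_closed codes_step)

definition code_ray :: "(nat \<Rightarrow> ('a \<Rightarrow> int \<times> 'c) \<times> 'a) \<Rightarrow> nat \<Rightarrow> 'a" where
  "code_ray a = (SOME c. c \<in> rays \<and> (\<forall>n. c (12 * d * n) = vertex a n))"

lemma code_ray: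
  assumes "a \<in> codes"
  shows "code_ray a \<in> rays" "code_ray a (12 * d * n) = vertex a n"
proof -
  have "12 * d > 0" using d_pos by simp
  then have "\<exists>c. c \<in> rays \<and> (\<forall>n. c (12 * d * n) = vertex a n)"
    using ray_through[of "12 * d" "vertex a"] vertex_closed[OF assms] vertex_label[OF assms]
      vertex_ds_Suc[OF assms] by metis
  then have "code_ray a \<in> rays \<and> (\<forall>n. code_ray a (12 * d * n) = vertex a n)"
    unfolding code_ray_def by (rule someI_ex)
  then show "code_ray a \<in> rays" "code_ray a (12 * d * n) = vertex a n" by auto
qed

definition ray_code :: "(nat \<Rightarrow> 'a) \<Rightarrow> nat \<Rightarrow> ('a \<Rightarrow> int \<times> 'c) \<times> 'a" where
  "ray_code c n = (label n (c (12 * d * n)), inv (c (12 * d * n)) \<otimes> c (12 * d * Suc n))"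

lemma ray_code:
  assumes c: "c \<in> rays"
  shows "ray_code c \<in> codes" "vertex (ray_code c) n = c (12 * d * n)"
proof -
  have step: "c (12 * d * n) \<otimes> snd (ray_code c n) = c (12 * d * Suc n)" for n
    using c by (simp add: ray_code_def m_assoc[symmetric] ray_closed)
  show "vertex (ray_code c) n = c (12 * d * n)"
    by (induction n) (use c step in \<open>simp_all add: ray_0\<close>)
  have "ray_code c n \<in> letters" for n
    using label_in_labels[of "c (12 * d * n)" n] c ray_ds[OF c, of "12 * d * n" "12 * d * Suc n"]
    by (simp add: letters_def ray_code_def ray_closed ray_len ds_def)
  moreover have "next_letter (ray_code c n) (ray_code c (Suc n))" for n
    unfolding next_letter_def
  proof (intro exI conjI)
    show "c (12 * d * n) \<in> carrier G" "len (c (12 * d * n)) = 12 * d * n"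
      using c by (auto simp: ray_closed ray_len)
    show "len (c (12 * d * n) \<otimes> snd (ray_code c n)) = len (c (12 * d * n)) + 12 * d"
      unfolding step using c by (simp add: ray_len)
    show "label (Suc n) (c (12 * d * n) \<otimes> snd (ray_code c n)) = fst (ray_code c (Suc n))"
      unfolding step by (simp add: ray_code_def)
  qed (simp add: ray_code_def)
  ultimately show "ray_code c \<in> codes" using c by (simp add: codes_def ray_code_def ray_0)
qed

text \<open>Since colours are proper at distance \<open>8 * d\<close>, the letters at time \<open>n\<close> of two codes determine
  the displacement \<open>g\<close> between their vertices, provided that it has length at most \<open>4 * d\<close>.\<close>

definition matches :: "('a \<Rightarrow> int \<times> 'c) \<Rightarrow> ('a \<Rightarrow> int \<times> 'c) \<Rightarrow> 'a \<Rightarrow> bool" where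
  "matches l m g \<longleftrightarrow> g \<in> carrier G \<and> len g \<le> 4 * d \<and> fst (l g) = 0 \<and> snd (l g) = snd (m \<one>)"

text \<open>\<open>g\<close> and \<open>g'\<close> are candidate displacements at consecutive times;
  the equation closes the quadrilateral formed by them and the two steps.\<close>

definition parallel_letters ::
    "(('a \<Rightarrow> int \<times> 'c) \<times> 'a) \<times> (('a \<Rightarrow> int \<times> 'c) \<times> 'a) \<Rightarrow>
     (('a \<Rightarrow> int \<times> 'c) \<times> 'a) \<times> (('a \<Rightarrow> int \<times> 'c) \<times> 'a) \<Rightarrow> bool" where
  "parallel_letters p q \<longleftrightarrow>
     (\<exists>g g'. matches (fst (fst p)) (fst (snd p)) g \<and> matches (fst (fst q)) (fst (snd q)) g' \<and>
        snd (fst p) \<otimes> g' = g \<otimes> snd (snd p))"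

lemma matches_label_iff:
  assumes "x \<in> carrier G" "y \<in> carrier G" "len x = len y"
  shows "matches (label n x) (label n y) g \<longleftrightarrow> g \<in> carrier G \<and> len g \<le> 4 * d \<and>
    len (x \<otimes> g) = len x \<and> colour n (x \<otimes> g) = colour n y"
  using assms by (auto simp: matches_def label_def)

text \<open>For close vertices the true displacements are witnesses. Conversely closeness is
  propagated from the common start \<open>\<one>\<close>: once \<open>g\<close> is identified as the
  true displacement, the equation does the same for \<open>g'\<close>.\<close>

lemma parallel_letters_iff:
  assumes a: "a \<in> codes" and b: "b \<in> codes"
  shows "(\<forall>n. parallel_letters (a n, b n) (a (Suc n), b (Suc n))) \<longleftrightarrow>
    (\<forall>n. ds (vertex a n) (vertex b n) \<le> 4 * d)"
proof -
  note cl = vertex_closed[OF a] vertex_closed[OF b] codes_step(1)[OF a] codes_step(1)[OF b]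
  have len: "len (vertex a n) = 12 * d * n" "len (vertex b n) = 12 * d * n" for n
    using vertex_label a b by auto
  have matches: "matches (fst (a n)) (fst (b n)) g \<longleftrightarrow> g \<in> carrier G \<and> len g \<le> 4 * d \<and>
    len (vertex a n \<otimes> g) = 12 * d * n \<and> colour n (vertex a n \<otimes> g) = colour n (vertex b n)" for n g
    using matches_label_iff[of "vertex a n" "vertex b n" n g] cl len vertex_label[OF a, of n]
      vertex_label[OF b, of n] by simp
  show ?thesis
  proof (intro iffI allI)
    fix n assume par: "\<forall>n. parallel_letters (a n, b n) (a (Suc n), b (Suc n))"
    show "ds (vertex a n) (vertex b n) \<le> 4 * d"
    proof (induction n)
      case (Suc n)
      obtain g g' where g: "matches (fst (a n)) (fst (b n)) g"
        and g': "matches (fst (a (Suc n))) (fst (b (Suc n))) g'"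
        and eq: "snd (a n) \<otimes> g' = g \<otimes> snd (b n)"
        using par unfolding parallel_letters_def by fastforce
      have "ds (vertex a n \<otimes> g) (vertex b n) \<le> ds (vertex a n \<otimes> g) (vertex a n) + ds (vertex a n) (vertex b n)"
        using g cl by (intro ds_triangle) (auto simp: matches)
      also have "ds (vertex a n \<otimes> g) (vertex a n) = len g"
        using g cl ds_commute[of "vertex a n \<otimes> g" "vertex a n"] by (simp add: matches)
      finally have "ds (vertex a n \<otimes> g) (vertex b n) \<le> 8 * d"
        using Suc g by (simp add: matches)
      \<comment> \<open>The distance bound \<open>8 * d\<close> is \<open>4 * d\<close> for
        \<open>g\<close> plus \<open>4 * d\<close> from the induction hypothesis, within the range
        where colours separate.\<close>
      then have "vertex a n \<otimes> g = vertex b n"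
        using colour_proper[of "vertex a n \<otimes> g" "vertex b n" n] g cl len by (simp add: matches)
      then have "vertex b (Suc n) = vertex a n \<otimes> (snd (a n) \<otimes> g')"
        using g cl eq by (simp add: matches m_assoc[symmetric])
      also have "\<dots> = vertex a (Suc n) \<otimes> g'"
        using g' cl by (simp add: matches m_assoc)
      finally show ?case using g' cl by (simp add: matches del: vertex.simps)
    qed simp
  next
    fix n assume close: "\<forall>n. ds (vertex a n) (vertex b n) \<le> 4 * d"
    define g where "g n = inv (vertex a n) \<otimes> vertex b n" for n
    have ag: "vertex a n \<otimes> g n = vertex b n" for n
      using cl by (simp add: g_def m_assoc[symmetric])
    have g: "g n \<in> carrier G" "len (g n) \<le> 4 * d" for n
      using cl close by (auto simp: g_def ds_def)
    have "matches (fst (a n)) (fst (b n)) (g n)" for n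
      using g ag len by (simp add: matches)
    moreover have "snd (a n) \<otimes> g (Suc n) = g n \<otimes> snd (b n)"
    proof -
      have "vertex a n \<otimes> (snd (a n) \<otimes> g (Suc n)) = vertex a n \<otimes> (g n \<otimes> snd (b n))"
        using ag[of "Suc n"] ag[of n] cl g by (simp add: m_assoc[symmetric])
      then show ?thesis using cl g by simp
    qed
    ultimately show "parallel_letters (a n, b n) (a (Suc n), b (Suc n))"
      unfolding parallel_letters_def by auto
  qed
qed

section \<open>The map from codes to boundary points\<close>

lemma asymptotic_code_rays_iff:
  assumes "a \<in> codes" "b \<in> codes"
  shows "asymptotic G S `` {code_ray a} = asymptotic G S `` {code_ray b} \<longleftrightarrow>
    (\<forall>n. ds (vertex a n) (vertex b n) \<le> 4 * d)"
proof -
  note a = code_ray[OF assms(1)] and b = code_ray[OF assms(2)]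
  have "asymptotic G S `` {code_ray a} = asymptotic G S `` {code_ray b} \<longleftrightarrow>
      (code_ray a, code_ray b) \<in> asymptotic G S"
    using eq_equiv_class_iff[OF equiv_asymptotic] a b by blast
  also have "\<dots> \<longleftrightarrow> (\<forall>n. ds (vertex a n) (vertex b n) \<le> 4 * d)"
  proof
    assume "(code_ray a, code_ray b) \<in> asymptotic G S"
    then show "\<forall>n. ds (vertex a n) (vertex b n) \<le> 4 * d"
      unfolding asymptotic_iff using a(2) b(2) by metis
  next
    assume "\<forall>n. ds (vertex a n) (vertex b n) \<le> 4 * d"
    then show "(code_ray a, code_ray b) \<in> asymptotic G S"
      using asymptotic_sampledI[OF a(1) b(1), of "12 * d" "4 * d"] d_pos a(2) b(2) by simp
  qed
  finally show ?thesis .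
qed

lemma code_rays_surj: "(\<lambda>a. asymptotic G S `` {code_ray a}) ` codes = boundary_points G S"
proof
  show "(\<lambda>a. asymptotic G S `` {code_ray a}) ` codes \<subseteq> boundary_points G S"
    using code_ray(1) by (auto simp: boundary_points_def quotientI)
  show "boundary_points G S \<subseteq> (\<lambda>a. asymptotic G S `` {code_ray a}) ` codes"
  proof
    fix p assume "p \<in> boundary_points G S"
    then obtain c where c: "c \<in> rays" "p = asymptotic G S `` {c}" by (rule boundary_pointE)
    note rc = ray_code[OF c(1)]
    \<comment> \<open>The two rays agree at every sampled time, so the bound there is 0.\<close>
    have "(c, code_ray (ray_code c)) \<in> asymptotic G S"
      using asymptotic_sampledI[OF c(1) code_ray(1)[OF rc(1)], of "12 * d" 0] d_pos
        code_ray(2)[OF rc(1)] rc(2) c by (simp add: ray_closed)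
    then have "p = asymptotic G S `` {code_ray (ray_code c)}"
      using c(2) equiv_class_eq[OF equiv_asymptotic] by simp
    then show "p \<in> (\<lambda>a. asymptotic G S `` {code_ray a}) ` codes" using rc(1) by blast
  qed
qed

theorem semi_Markovian_gromov_boundary: "semi_Markovian_space (gromov_boundary G S)"
proof (rule semi_Markovian_spaceI[where L = letters and I = "\<lambda>x. fst x = label 0 \<one>"
      and T = next_letter and f = "\<lambda>a. asymptotic G S `` {code_ray a}" and Q = parallel_letters,
      folded codes_def])
  show "finite letters"
    unfolding letters_def using finite_labels
    by (intro finite_SigmaI finite_subset[OF _ finite_ball[of "12 * d"]]) auto
  show "Hausdorff_space (gromov_boundary G S)" by (rule Hausdorff_gromov_boundary)
  show "(\<lambda>a. asymptotic G S `` {code_ray a}) ` codes = topspace (gromov_boundary G S)"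
    using code_rays_surj by simp
  show "asymptotic G S `` {code_ray a} = asymptotic G S `` {code_ray b} \<longleftrightarrow>
      (\<forall>n. parallel_letters (a n, b n) (a (Suc n), b (Suc n)))" if "a \<in> codes" "b \<in> codes" for a b
    using asymptotic_code_rays_iff parallel_letters_iff that by simp
  show "\<exists>N. \<forall>b\<in>codes. (\<forall>i<N. b i = a i) \<longrightarrow> asymptotic G S `` {code_ray b} \<in> U"
    if a: "a \<in> codes" and U: "openin (gromov_boundary G S) U" "asymptotic G S `` {code_ray a} \<in> U" for a U
  proof -
    obtain N where N: "\<And>c n. \<lbrakk>c \<in> rays; n \<ge> N; code_ray a n = c n\<rbrakk> \<Longrightarrow> asymptotic G S `` {c} \<in> U"
      using ray_class_continuous[OF code_ray(1)[OF a] U] by blast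
    have "asymptotic G S `` {code_ray b} \<in> U" if b: "b \<in> codes" "\<forall>i<N. b i = a i" for b
    proof (rule N[OF code_ray(1)[OF b(1)]])
      \<comment> \<open>The first \<open>N\<close> letters fix the vertex at time
        \<open>12 * d * N\<close>, which is late enough for \<open>N\<close>.\<close>
      show "12 * d * N \<ge> N" using d_pos by simp
      show "code_ray a (12 * d * N) = code_ray b (12 * d * N)"
        using code_ray(2)[OF a] code_ray(2)[OF b(1)] vertex_cong[OF b(2)] by simp
    qed
    then show ?thesis by blast
  qed
qed

end

theorem theorem0p3:
  fixes G :: "('a, 'm) monoid_scheme" and S :: "'a set"
  assumes "group G"
    and "finite S" and "S \<subseteq> carrier G" and "generate G S = carrier G"
    and "gromov_hyperbolic (carrier G) (word_dist G S)"
  shows "semi_Markovian_space (gromov_boundary G S)"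
proof -
  interpret group G by fact
  interpret finitely_generated_group G S
    by unfold_locales (use assms in auto)
  obtain d where "hyperbolic_group G S d" using hyperbolic_groupI[OF assms(5)] .
  then interpret hyperbolic_group G S d .
  \<comment> \<open>\<open>?P\<close> contains all descents, and \<open>?k\<close> bounds the number
    of neighbours compared when a vertex is coloured.\<close>
  let ?P = "{h \<in> carrier G. len h \<le> 12 * d}" and ?k = "card {g \<in> carrier G. len g \<le> 8 * d}"
  show ?thesis
  proof (rule colour_reduction[of ?P ?k])
    show "finite ?P" by (rule finite_ball)
    fix C and \<Phi> :: "(nat set \<times> nat set) \<times> 'a \<Rightarrow> ((nat set \<times> nat set) \<times> 'a) set \<Rightarrow> nat set \<times> nat set"
    assume "finite C" "({}, {}) \<in> C"
      and "\<And>e N. \<lbrakk>e \<in> C \<times> ?P; N \<subseteq> C \<times> ?P; card N \<le> ?k\<rbrakk> \<Longrightarrow> \<Phi> e N \<in> C"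
      and "\<And>e e' N N'. \<lbrakk>e \<in> C \<times> ?P; e' \<in> C \<times> ?P; e' \<in> N; \<Phi> e N = \<Phi> e' N'\<rbrakk> \<Longrightarrow> e = e'"
    then interpret coloured_hyperbolic_group G S d C "({}, {})" \<Phi>
      by unfold_locales
    show ?thesis by (rule semi_Markovian_gromov_boundary)
  qed
qed

end
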